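(* Let $L,\rho,\mu,\beta,\alpha_1>0$, $\gamma\in\mathbb{R}$, $\alpha=\alpha_1+\gamma^2\beta$, and let $\xi_1,\xi_2>0$. Consider the closed-loop system on $x\in(0,L)$, $t>0$, $$\rho v_{tt}-\alpha v_{xx}+\gamma\beta p_{xx}=0,\qquad \mu p_{tt}-\beta p_{xx}+\gamma\beta v_{xx}=0,$$ $$v(0,t)=p(0,t)=0,\quad \alpha v_x(L,t)-\gamma\beta p_x(L,t)=-\xi_1 v_t(L,t),\quad \beta p_x(L,t)-\gamma\beta v_x(L,t)=-\xi_2 p_t(L,t),$$ with initial data $[v,p,v_t,p_t](x,0)=[v_0,p_0,v_1,p_1](x)$ in $\mathcal{H}$, and let $E(t)$ be its energy. Set $$\eta=\max\left(\sqrt{\tfrac{\rho}{\alpha_1}}+\sqrt{\tfrac{\mu\gamma^2}{\alpha_1}},\ \sqrt{\tfrac{\mu}{\beta}}+\sqrt{\tfrac{\mu\gamma^2}{\alpha_1}}\right),$$ and, for $\epsilon>0$, $$f_1(\xi_1,\epsilon)=\frac{2\xi_1\alpha_1}{\rho\alpha_1+(1+\epsilon)\xi_1^2},\qquad f_2(\xi_2,\epsilon)=\frac{2\xi_2\epsilon\alpha_1\beta}{\epsilon\mu\alpha_1\beta+(\epsilon\alpha+\gamma^2\beta)\xi_2^2}.$$ Then for every $\epsilon>0$ and every $\delta>0$ with $$\delta<\frac1L\min\left(\frac1\eta,\ f_1(\xi_1,\epsilon),\ f_2(\xi_2,\epsilon)\right),$$ every solution satisfies $$E(t)\le M\,E(0)\,e^{-\sigma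 t}\quad\text{for all } t>0,\qquad\text{where } \sigma=\delta(1-\delta L\eta),\quad M=\frac{1+\delta L\eta}{1-\delta L\eta}.$$
   Context: All functions are real-valued. $H^1_*(0,L)=\{z\in H^1(0,L): z(0)=0\}$ and $\mathcal{H}=(H^1_*(0,L))^2\times(L^2(0,L))^2$. The energy of a solution is $$E(t)=\frac12\int_0^L\left[\rho|v_t|^2+\mu|p_t|^2+\alpha_1|v_x|^2+\beta|\gamma v_x-p_x|^2\right]dx.$$ A strong solution is a pair $(v,p)$ in $C([0,\infty);(H^2(0,L)\cap H^1_*(0,L))^2)\cap C^1([0,\infty);(H^1_*(0,L))^2)\cap C^2([0,\infty);(L^2(0,L))^2)$ satisfying the equations and boundary conditions. A solution with initial data in $\mathcal{H}$ is the weak (semigroup) solution $(v,p,v_t,p_t)\in C([0,\infty);\mathcal{H})$, i.e. the limit in $C([0,T];\mathcal{H})$, for every $T>0$, of strong solutions. *)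

theory Defs
  imports "HOL-Analysis.Analysis"
begin

(* Elements of the function spaces are represented by functions real => real, of which only the
   restriction to (0,L) matters, up to null sets.  Every notion below is invariant under changing
   a representative on a null set. *)

definition L2 :: "real \<Rightarrow> (real \<Rightarrow> real) set" where
  "L2 L = {f. f \<in> borel_measurable (lebesgue_on {0<..<L}) \<and>
              integrable (lebesgue_on {0<..<L}) (\<lambda>x. (f x)\<^sup>2)}"

definition L2_norm :: "real \<Rightarrow> (real \<Rightarrow> real) \<Rightarrow> real" where
  "L2_norm L f = sqrt (\<integral>x. (f x)\<^sup>2 \<partial>lebesgue_on {0<..<L})"

(* Test functions are of class C^1 with compact support in (0,L), as in Brezis' textbook definition
   of Sobolev spaces on an interval; by mollification this gives the same weak derivatives as
   smooth test functions. *)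
definition test_function :: "real \<Rightarrow> (real \<Rightarrow> real) \<Rightarrow> bool" where
  "test_function L \<phi> \<longleftrightarrow> \<phi> C1_differentiable_on UNIV \<and>
     compact (closure {x. \<phi> x \<noteq> 0}) \<and> closure {x. \<phi> x \<noteq> 0} \<subseteq> {0<..<L}"

definition is_weak_deriv :: "real \<Rightarrow> (real \<Rightarrow> real) \<Rightarrow> (real \<Rightarrow> real) \<Rightarrow> bool" where
  "is_weak_deriv L z g \<longleftrightarrow> (\<forall>\<phi>. test_function L \<phi> \<longrightarrow>
     (\<integral>x. z x * deriv \<phi> x \<partial>lebesgue_on {0<..<L}) = - (\<integral>x. g x * \<phi> x \<partial>lebesgue_on {0<..<L}))"

definition H1 :: "real \<Rightarrow> (real \<Rightarrow> real) set" where
  "H1 L = {z \<in> L2 L. \<exists>g \<in> L2 L. is_weak_deriv L z g}"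

(* For z in H1, the weak derivative z_x; it is unique up to null sets. *)
definition wderiv :: "real \<Rightarrow> (real \<Rightarrow> real) \<Rightarrow> real \<Rightarrow> real" where
  "wderiv L z = (SOME g. g \<in> L2 L \<and> is_weak_deriv L z g)"

definition H1_norm :: "real \<Rightarrow> (real \<Rightarrow> real) \<Rightarrow> real" where
  "H1_norm L z = sqrt ((L2_norm L z)\<^sup>2 + (L2_norm L (wderiv L z))\<^sup>2)"

definition H2 :: "real \<Rightarrow> (real \<Rightarrow> real) set" where
  "H2 L = {z \<in> H1 L. wderiv L z \<in> H1 L}"

definition H2_norm :: "real \<Rightarrow> (real \<Rightarrow> real) \<Rightarrow> real" where
  "H2_norm L z = sqrt ((L2_norm L z)\<^sup>2 + (L2_norm L (wderiv L z))\<^sup>2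
                       + (L2_norm L (wderiv L (wderiv L z)))\<^sup>2)"

(* Point values z(x), 0 <= x <= L, of z in H1 are those of its continuous representative on [0,L]
   (which exists because H1 embeds into C[0,L], and is unique on [0,L]). *)
definition point_value :: "real \<Rightarrow> (real \<Rightarrow> real) \<Rightarrow> real \<Rightarrow> real" where
  "point_value L z = (SOME c. continuous_on {0..L} c \<and> (AE x in lebesgue_on {0<..<L}. c x = z x))"

definition H1_star :: "real \<Rightarrow> (real \<Rightarrow> real) set" where
  "H1_star L = {z \<in> H1 L. point_value L z 0 = 0}"

definition energy_space ::
    "real \<Rightarrow> ((real \<Rightarrow> real) \<times> (real \<Rightarrow> real) \<times> (real \<Rightarrow> real) \<times> (real \<Rightarrow> real)) set" where
  "energy_space L = H1_star L \<times> H1_star L \<times> L2 L \<times> L2 L"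

definition energy_space_norm ::
    "real \<Rightarrow> (real \<Rightarrow> real) \<times> (real \<Rightarrow> real) \<times> (real \<Rightarrow> real) \<times> (real \<Rightarrow> real) \<Rightarrow> real" where
  "energy_space_norm L = (\<lambda>(v, p, w, q).
     sqrt ((H1_norm L v)\<^sup>2 + (H1_norm L p)\<^sup>2 + (L2_norm L w)\<^sup>2 + (L2_norm L q)\<^sup>2))"

(* C([0,\<infinity>); X), where the topology on X comes from the (semi)norm N.  Differences of
   functions, and of tuples of functions, are pointwise. *)
definition continuous_curve :: "'a::minus set \<Rightarrow> ('a \<Rightarrow> real) \<Rightarrow> (real \<Rightarrow> 'a) \<Rightarrow> bool" where
  "continuous_curve X N u \<longleftrightarrow> (\<forall>t\<ge>0. u t \<in> X) \<and>
     (\<forall>t\<ge>0. ((\<lambda>s. N (u s - u t)) \<longlongrightarrow> 0) (at t within {0..}))"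

definition has_curve_deriv ::
    "(real \<Rightarrow> real) set \<Rightarrow> ((real \<Rightarrow> real) \<Rightarrow> real) \<Rightarrow> (real \<Rightarrow> real \<Rightarrow> real) \<Rightarrow> real \<Rightarrow> (real \<Rightarrow> real) \<Rightarrow> bool" where
  "has_curve_deriv X N u t d \<longleftrightarrow> d \<in> X \<and>
     ((\<lambda>s. N (\<lambda>x. (u s x - u t x) / (s - t) - d x)) \<longlongrightarrow> 0) (at t within {0..})"

(* C^k([0,\<infinity>); X) *)
fun Ck_curve ::
    "nat \<Rightarrow> (real \<Rightarrow> real) set \<Rightarrow> ((real \<Rightarrow> real) \<Rightarrow> real) \<Rightarrow> (real \<Rightarrow> real \<Rightarrow> real) \<Rightarrow> bool" where
  "Ck_curve 0 X N u \<longleftrightarrow> continuous_curve X N u"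
| "Ck_curve (Suc k) X N u \<longleftrightarrow> continuous_curve X N u \<and>
     (\<exists>u'. (\<forall>t\<ge>0. has_curve_deriv X N u t (u' t)) \<and> Ck_curve k X N u')"

(* u_t: the time derivative of u, as a curve in L2 (hence also as one in H1, where that exists).
   Space-time functions take time as their first argument: u t x. *)
definition tderiv :: "real \<Rightarrow> (real \<Rightarrow> real \<Rightarrow> real) \<Rightarrow> real \<Rightarrow> real \<Rightarrow> real" where
  "tderiv L u t = (SOME d. has_curve_deriv (L2 L) (L2_norm L) u t d)"

definition strong_regularity :: "real \<Rightarrow> (real \<Rightarrow> real \<Rightarrow> real) \<Rightarrow> bool" where
  "strong_regularity L u \<longleftrightarrow>
     Ck_curve 0 (H2 L \<inter> H1_star L) (H2_norm L) u \<and>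
     Ck_curve 1 (H1_star L) (H1_norm L) u \<and>
     Ck_curve 2 (L2 L) (L2_norm L) u"

definition strong_solution ::
    "real \<Rightarrow> real \<Rightarrow> real \<Rightarrow> real \<Rightarrow> real \<Rightarrow> real \<Rightarrow> real \<Rightarrow> real \<Rightarrow>
     (real \<Rightarrow> real \<Rightarrow> real) \<Rightarrow> (real \<Rightarrow> real \<Rightarrow> real) \<Rightarrow> bool" where
  "strong_solution L \<rho> \<mu> \<alpha> \<beta> \<gamma> \<xi>\<^sub>1 \<xi>\<^sub>2 v p \<longleftrightarrow>
     strong_regularity L v \<and> strong_regularity L p \<and>
     (\<forall>t>0.
        (AE x in lebesgue_on {0<..<L}.
           \<rho> * tderiv L (tderiv L v) t x - \<alpha> * wderiv L (wderiv L (v t)) x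
             + \<gamma> * \<beta> * wderiv L (wderiv L (p t)) x = 0) \<and>
        (AE x in lebesgue_on {0<..<L}.
           \<mu> * tderiv L (tderiv L p) t x - \<beta> * wderiv L (wderiv L (p t)) x
             + \<gamma> * \<beta> * wderiv L (wderiv L (v t)) x = 0) \<and>
        point_value L (v t) 0 = 0 \<and> point_value L (p t) 0 = 0 \<and>
        \<alpha> * point_value L (wderiv L (v t)) L - \<gamma> * \<beta> * point_value L (wderiv L (p t)) L
          = - \<xi>\<^sub>1 * point_value L (tderiv L v t) L \<and>
        \<beta> * point_value L (wderiv L (p t)) L - \<gamma> * \<beta> * point_value L (wderiv L (v t)) L
          = - \<xi>\<^sub>2 * point_value L (tderiv L p t) L)"

definition state ::
    "real \<Rightarrow> (real \<Rightarrow> real \<Rightarrow> real) \<Rightarrow> (real \<Rightarrow> real \<Rightarrow> real) \<Rightarrow> real \<Rightarrow>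
     (real \<Rightarrow> real) \<times> (real \<Rightarrow> real) \<times> (real \<Rightarrow> real) \<times> (real \<Rightarrow> real)" where
  "state L v p t = (v t, p t, tderiv L v t, tderiv L p t)"

(* Weak (semigroup) solution: the state is continuous into the energy space and is the limit, in
   C([0,T]; energy space) for every T > 0, of the states of a sequence of strong solutions. *)
definition weak_solution ::
    "real \<Rightarrow> real \<Rightarrow> real \<Rightarrow> real \<Rightarrow> real \<Rightarrow> real \<Rightarrow> real \<Rightarrow> real \<Rightarrow>
     (real \<Rightarrow> real \<Rightarrow> real) \<Rightarrow> (real \<Rightarrow> real \<Rightarrow> real) \<Rightarrow> bool" where
  "weak_solution L \<rho> \<mu> \<alpha> \<beta> \<gamma> \<xi>\<^sub>1 \<xi>\<^sub>2 v p \<longleftrightarrow>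
     continuous_curve (energy_space L) (energy_space_norm L) (state L v p) \<and>
     (\<exists>vs ps :: nat \<Rightarrow> real \<Rightarrow> real \<Rightarrow> real.
        (\<forall>n. strong_solution L \<rho> \<mu> \<alpha> \<beta> \<gamma> \<xi>\<^sub>1 \<xi>\<^sub>2 (vs n) (ps n)) \<and>
        (\<forall>T>0. uniform_limit {0..T}
           (\<lambda>n t. energy_space_norm L (state L (vs n) (ps n) t - state L v p t)) (\<lambda>_. 0) sequentially))"

definition has_initial_data ::
    "real \<Rightarrow> (real \<Rightarrow> real \<Rightarrow> real) \<Rightarrow> (real \<Rightarrow> real \<Rightarrow> real) \<Rightarrow>
     (real \<Rightarrow> real) \<Rightarrow> (real \<Rightarrow> real) \<Rightarrow> (real \<Rightarrow> real) \<Rightarrow> (real \<Rightarrow> real) \<Rightarrow> bool" where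
  "has_initial_data L v p v\<^sub>0 p\<^sub>0 v\<^sub>1 p\<^sub>1 \<longleftrightarrow>
     (AE x in lebesgue_on {0<..<L}. v 0 x = v\<^sub>0 x \<and> p 0 x = p\<^sub>0 x \<and>
        tderiv L v 0 x = v\<^sub>1 x \<and> tderiv L p 0 x = p\<^sub>1 x)"

definition energy ::
    "real \<Rightarrow> real \<Rightarrow> real \<Rightarrow> real \<Rightarrow> real \<Rightarrow> real \<Rightarrow>
     (real \<Rightarrow> real \<Rightarrow> real) \<Rightarrow> (real \<Rightarrow> real \<Rightarrow> real) \<Rightarrow> real \<Rightarrow> real" where
  "energy L \<rho> \<mu> \<alpha>\<^sub>1 \<beta> \<gamma> v p t = 1 / 2 *
     (\<integral>x. \<rho> * \<bar>tderiv L v t x\<bar>\<^sup>2 + \<mu> * \<bar>tderiv L p t x\<bar>\<^sup>2 + \<alpha>\<^sub>1 * \<bar>wderiv L (v t) x\<bar>\<^sup>2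
         + \<beta> * \<bar>\<gamma> * wderiv L (v t) x - wderiv L (p t) x\<bar>\<^sup>2 \<partial>lebesgue_on {0<..<L})"

end

theory Submission
  imports Defs
begin

text \<open>
  Write \<open>a = v\<^sub>t\<close>, \<open>b = p\<^sub>t\<close>, \<open>c = v\<^sub>x\<close>, \<open>d = p\<^sub>x\<close> and let \<open>e\<close> be the energy density. For a strong
  solution consider the Lyapunov functional \<open>V = E + \<delta> \<psi>\<close> with the multiplier term
  \<open>\<psi> = \<integral> x (\<rho> a c + \<mu> b d) dx\<close>. By the equations and integration by parts, \<open>\<psi>' = L e(L) - E\<close>, while
  \<open>E'\<close> is the boundary term \<open>- \<xi>\<^sub>1 a(L)\<^sup>2 - \<xi>\<^sub>2 b(L)\<^sup>2\<close>. The boundary conditions express \<open>c(L)\<close> and \<open>d(L)\<close>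
  through \<open>a(L)\<close> and \<open>b(L)\<close>, and the bounds of \<open>\<delta> L\<close> by \<open>f\<^sub>1\<close> and \<open>f\<^sub>2\<close> say exactly that, after Young's
  inequality with parameter \<open>\<epsilon>\<close>, the boundary terms of \<open>V'\<close> are nonpositive; hence \<open>V' \<le> - \<delta> E\<close>.
  Since \<open>\<bar>\<psi>\<bar> \<le> L \<eta> E\<close>, the functionals \<open>V\<close> and \<open>E\<close> are equivalent and Gronwall's argument gives the rate
  \<open>\<delta> / (1 + \<delta> L \<eta>) \<ge> \<delta> (1 - \<delta> L \<eta>)\<close>. The estimate passes to weak solutions because \<open>E\<close> is
  continuous for the norm of the energy space.
\<close>

section \<open>Square-integrable functions\<close>

text \<open>The obstacle is regularity. The derivatives in x and in t are functions picked by
  choice, determined only up to null sets, so neither calculus rule used for V' is classical. In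
  time, the product rule is proved for norm limits of difference quotients in \<open>L2\<close>. In
  space, integration by parts is proved for absolutely continuous functions
  (\<open>primitive_on\<close>). The lemma of du Bois-Reymond supplies the continuous
  representatives whose values at 0 and L form the boundary terms. The weight x in the multiplier
  vanishes at 0, where nothing is known about \<open>c\<close> and \<open>d\<close>, and its
  derivative 1 is what produces -E in the interior. The algebra rests on y = \<gamma> c - d, which
  diagonalises the strain energy: \<alpha> c^2 - 2 \<gamma> \<beta> c d + \<beta> d^2 becomes
  \<open>\<alpha>\<^sub>1 * c\<^sup>2 + \<beta> * y\<^sup>2\<close>. In this variable the boundary
  conditions can be solved one after the other, and the constant \<eta> arises by writing d =
  \<gamma> c - y in the multiplier.\<close>

lemma L2_measurable: "f \<in> L2 L \<Longrightarrow> f \<in> borel_measurable (lebesgue_on {0<..<L})"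
  by (simp add: L2_def)

lemma L2_integrable_square: "f \<in> L2 L \<Longrightarrow> integrable (lebesgue_on {0<..<L}) (\<lambda>x. (f x)\<^sup>2)"
  by (simp add: L2_def)

lemma L2_integrable_mult:
  assumes "f \<in> L2 L" "g \<in> L2 L"
  shows "integrable (lebesgue_on {0<..<L}) (\<lambda>x. f x * g x)"
proof (rule Bochner_Integration.integrable_bound)
  show "integrable (lebesgue_on {0<..<L}) (\<lambda>x. (f x)\<^sup>2 + (g x)\<^sup>2)"
    using assms by (auto simp: L2_def)
  show "(\<lambda>x. f x * g x) \<in> borel_measurable (lebesgue_on {0<..<L})"
    using assms by (auto simp: L2_def)
  have "\<bar>f x * g x\<bar> \<le> (f x)\<^sup>2 + (g x)\<^sup>2" for x
  proof -
    have "2 * (\<bar>f x\<bar> * \<bar>g x\<bar>) \<le> (f x)\<^sup>2 + (g x)\<^sup>2"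
      using sum_squares_bound[of "\<bar>f x\<bar>" "\<bar>g x\<bar>"] by (simp add: mult.assoc)
    moreover have "0 \<le> \<bar>f x\<bar> * \<bar>g x\<bar>"
      by simp
    ultimately show ?thesis
      unfolding abs_mult by linarith
  qed
  then show "AE x in lebesgue_on {0<..<L}. norm (f x * g x) \<le> norm ((f x)\<^sup>2 + (g x)\<^sup>2)"
    by (intro AE_I2) auto
qed

lemma L2_add: "f \<in> L2 L \<Longrightarrow> g \<in> L2 L \<Longrightarrow> (\<lambda>x. f x + g x) \<in> L2 L"
  using L2_integrable_mult[of f L g]
  by (auto simp: L2_def power2_sum mult.assoc intro!: Bochner_Integration.integrable_add)

lemma L2_scale: "f \<in> L2 L \<Longrightarrow> (\<lambda>x. c * f x) \<in> L2 L"
  by (auto simp: L2_def power_mult_distrib)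

lemma L2_diff: "f \<in> L2 L \<Longrightarrow> g \<in> L2 L \<Longrightarrow> (\<lambda>x. f x - g x) \<in> L2 L"
  using L2_add[of f L "\<lambda>x. -1 * g x"] L2_scale[of g L "-1"] by simp

lemma L2_divide: "f \<in> L2 L \<Longrightarrow> (\<lambda>x. f x / c) \<in> L2 L"
  using L2_scale[of f L "1/c"] by simp

lemma L2_zero: "(\<lambda>x. 0) \<in> L2 L"
  by (auto simp: L2_def)

lemma L2_integrable:
  assumes "f \<in> L2 L"
  shows "integrable (lebesgue_on {0<..<L}) f"
proof -
  interpret finite_measure "lebesgue_on {0<..<L}"
    by (rule finite_measure_lebesgue_on) simp
  show ?thesis
    using assms by (auto simp: L2_def intro: square_integrable_imp_integrable)
qed

lemma L2_norm_nonneg [simp]: "0 \<le> L2_norm L f"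
  by (simp add: L2_norm_def)

lemma L2_norm_power2: "(L2_norm L f)\<^sup>2 = (\<integral>x. (f x)\<^sup>2 \<partial>lebesgue_on {0<..<L})"
  by (simp add: L2_norm_def)

lemma L2_norm_scale: "L2_norm L (\<lambda>x. c * f x) = \<bar>c\<bar> * L2_norm L f"
  by (simp add: L2_norm_def power_mult_distrib real_sqrt_mult)

lemma L2_norm_cong_AE:
  assumes "f \<in> L2 L" "g \<in> L2 L" "AE x in lebesgue_on {0<..<L}. f x = g x"
  shows "L2_norm L f = L2_norm L g"
  unfolding L2_norm_def using assms
  by (intro arg_cong[where f = sqrt] integral_cong_AE) (auto simp: L2_def)

lemma L2_norm_eq_0_AE:
  assumes "f \<in> L2 L" "L2_norm L f = 0"
  shows "AE x in lebesgue_on {0<..<L}. f x = 0"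
  using assms integral_nonneg_eq_0_iff_AE[of "lebesgue_on {0<..<L}" "\<lambda>x. (f x)\<^sup>2"]
  by (auto simp: L2_def L2_norm_def)

lemma L2_Cauchy_Schwarz:
  assumes "f \<in> L2 L" "g \<in> L2 L"
  shows "\<bar>\<integral>x. f x * g x \<partial>lebesgue_on {0<..<L}\<bar> \<le> L2_norm L f * L2_norm L g"
proof -
  let ?M = "lebesgue_on {0<..<L}"
  let ?A = "L2_norm L f" and ?B = "L2_norm L g" and ?I = "\<integral>x. f x * g x \<partial>?M"
  have sq: "0 \<le> a\<^sup>2 * ?A\<^sup>2 + 2 * a * b * ?I + b\<^sup>2 * ?B\<^sup>2" for a b
  proof -
    have "0 \<le> (\<integral>x. (a * f x + b * g x)\<^sup>2 \<partial>?M)" by simp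
    also have "\<dots> = (\<integral>x. a\<^sup>2 * (f x)\<^sup>2 + (2 * a * b * (f x * g x) + b\<^sup>2 * (g x)\<^sup>2) \<partial>?M)"
      by (rule Bochner_Integration.integral_cong) (auto simp: power2_eq_square algebra_simps)
    also have "\<dots> = a\<^sup>2 * ?A\<^sup>2 + 2 * a * b * ?I + b\<^sup>2 * ?B\<^sup>2"
      by (simp add: L2_norm_power2 L2_integrable_mult assms L2_integrable_square)
    finally show ?thesis .
  qed
  \<comment> \<open>The values a = B^2 and b = -I minimise the quadratic form up to scaling and need
    no division, so B = 0 can be settled separately: then g vanishes almost everywhere.\<close>
  have "0 \<le> (?B\<^sup>2) * (?A\<^sup>2 * ?B\<^sup>2 - ?I\<^sup>2)"
    using sq[of "?B\<^sup>2" "-?I"] by (simp add: power2_eq_square algebra_simps)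
  moreover have "?I = 0" if "?B = 0"
    by (rule integral_eq_zero_AE) (use L2_norm_eq_0_AE[OF assms(2) that] in auto)
  ultimately have "?I\<^sup>2 \<le> (?A * ?B)\<^sup>2"
    by (cases "?B = 0") (auto simp: zero_le_mult_iff power_mult_distrib)
  then show ?thesis
    by (metis L2_norm_nonneg abs_le_square_iff abs_of_nonneg mult_nonneg_nonneg)
qed

lemma L2_norm_triangle:
  assumes "f \<in> L2 L" "g \<in> L2 L"
  shows "L2_norm L (\<lambda>x. f x + g x) \<le> L2_norm L f + L2_norm L g"
proof (rule power2_le_imp_le)
  have "(L2_norm L (\<lambda>x. f x + g x))\<^sup>2
      = (\<integral>x. (f x)\<^sup>2 + (2 * (f x * g x) + (g x)\<^sup>2) \<partial>lebesgue_on {0<..<L})"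
    unfolding L2_norm_power2
    by (rule Bochner_Integration.integral_cong) (auto simp: power2_eq_square algebra_simps)
  also have "\<dots> = (L2_norm L f)\<^sup>2 + 2 * (\<integral>x. f x * g x \<partial>lebesgue_on {0<..<L}) + (L2_norm L g)\<^sup>2"
    by (simp add: L2_norm_power2 L2_integrable_mult assms L2_integrable_square)
  also have "\<dots> \<le> (L2_norm L f + L2_norm L g)\<^sup>2"
    using L2_Cauchy_Schwarz[OF assms] by (simp add: power2_sum)
  finally show "(L2_norm L (\<lambda>x. f x + g x))\<^sup>2 \<le> (L2_norm L f + L2_norm L g)\<^sup>2" .
qed simp

text \<open>Stated for a general filter with eventual membership, since it serves both sequences of
  solutions and difference quotients in time; the latter are controlled only at nonnegative
  times.\<close>

lemma L2_integral_mult_tendsto: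
  assumes L2: "\<forall>\<^sub>F n in F. f n \<in> L2 L" "\<forall>\<^sub>F n in F. g n \<in> L2 L"
    and lims: "f' \<in> L2 L" "g' \<in> L2 L"
    and f: "((\<lambda>n. L2_norm L (\<lambda>x. f n x - f' x)) \<longlongrightarrow> 0) F"
    and g: "((\<lambda>n. L2_norm L (\<lambda>x. g n x - g' x)) \<longlongrightarrow> 0) F"
  shows "((\<lambda>n. \<integral>x. f n x * g n x \<partial>lebesgue_on {0<..<L}) \<longlongrightarrow>
           (\<integral>x. f' x * g' x \<partial>lebesgue_on {0<..<L})) F"
proof -
  let ?M = "lebesgue_on {0<..<L}"
  let ?a = "\<lambda>n. L2_norm L (\<lambda>x. f n x - f' x)" and ?b = "\<lambda>n. L2_norm L (\<lambda>x. g n x - g' x)"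
  have bound: "norm ((\<integral>x. f n x * g n x \<partial>?M) - (\<integral>x. f' x * g' x \<partial>?M))
      \<le> ?a n * ?b n + ?a n * L2_norm L g' + L2_norm L f' * ?b n"
    if fg: "f n \<in> L2 L" "g n \<in> L2 L" for n
  proof -
    have d: "(\<lambda>x. f n x - f' x) \<in> L2 L" "(\<lambda>x. g n x - g' x) \<in> L2 L"
      using lims fg by (auto intro: L2_diff)
    have "(\<integral>x. f n x * g n x \<partial>?M) - (\<integral>x. f' x * g' x \<partial>?M)
        = (\<integral>x. f n x * g n x - f' x * g' x \<partial>?M)"
      using lims fg L2_integrable_mult by simp
    also have "\<dots> = (\<integral>x. (f n x - f' x) * (g n x - g' x) + ((f n x - f' x) * g' x
        + f' x * (g n x - g' x)) \<partial>?M)"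
      by (rule Bochner_Integration.integral_cong) (auto simp: algebra_simps)
    also have "\<dots> = (\<integral>x. (f n x - f' x) * (g n x - g' x) \<partial>?M) + ((\<integral>x. (f n x - f' x) * g' x \<partial>?M)
        + (\<integral>x. f' x * (g n x - g' x) \<partial>?M))"
      by (simp add: L2_integrable_mult lims d)
    finally show ?thesis
      using L2_Cauchy_Schwarz[OF d] L2_Cauchy_Schwarz[OF d(1) lims(2)]
        L2_Cauchy_Schwarz[OF lims(1) d(2)] by simp
  qed
  have "((\<lambda>n. ?a n * ?b n + ?a n * L2_norm L g' + L2_norm L f' * ?b n) \<longlongrightarrow>
        0 * 0 + 0 * L2_norm L g' + L2_norm L f' * 0) F"
    by (intro tendsto_intros f g)
  then have "((\<lambda>n. ?a n * ?b n + ?a n * L2_norm L g' + L2_norm L f' * ?b n) \<longlongrightarrow> 0) F"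
    by simp
  moreover have "\<forall>\<^sub>F n in F. norm ((\<integral>x. f n x * g n x \<partial>?M) - (\<integral>x. f' x * g' x \<partial>?M))
      \<le> ?a n * ?b n + ?a n * L2_norm L g' + L2_norm L f' * ?b n"
    using L2 by eventually_elim (rule bound)
  ultimately have "((\<lambda>n. (\<integral>x. f n x * g n x \<partial>?M) - (\<integral>x. f' x * g' x \<partial>?M)) \<longlongrightarrow> 0) F"
    by (rule Lim_null_comparison[rotated])
  then show ?thesis
    by (rule LIM_zero_cancel)
qed

section \<open>Primitives of integrable functions\<close>

text \<open>Absolute continuity of \<open>F\<close> on [0,L] with density \<open>f\<close>. The
  variable endpoint sits in an indicator, so that every integral is over one fixed measure, as
  Fubini and dominated convergence require.\<close>

definition primitive_on :: "real \<Rightarrow> (real \<Rightarrow> real) \<Rightarrow> (real \<Rightarrow> real) \<Rightarrow> bool" where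
  "primitive_on L F f \<longleftrightarrow> integrable (lebesgue_on {0<..<L}) f \<and>
     (\<forall>x\<in>{0..L}. F x = F 0 + (\<integral>y. indicator {..<x} y * f y \<partial>lebesgue_on {0<..<L}))"

lemma primitive_on_integrable: "primitive_on L F f \<Longrightarrow> integrable (lebesgue_on {0<..<L}) f"
  by (simp only: primitive_on_def)

lemma primitive_on_eq:
  "primitive_on L F f \<Longrightarrow> x \<in> {0..L} \<Longrightarrow>
    F x = F 0 + (\<integral>y. indicator {..<x} y * f y \<partial>lebesgue_on {0<..<L})"
  by (simp only: primitive_on_def)

lemma integrable_indicator_lessThan:
  fixes f :: "real \<Rightarrow> real"
  assumes "integrable (lebesgue_on S) f"
  shows "integrable (lebesgue_on S) (\<lambda>y. indicator {..<x} y * f y)"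
proof -
  have "integrable (lebesgue_on S) (\<lambda>y. indicator ({..<x} \<inter> S) y *\<^sub>R f y)"
    by (rule integrable_mult_indicator[OF _ assms])
      (metis Int_commute lessThan_borel sets.Int_space_eq2 sets_completionI_sets sets_lborel sets_restrict_space image_eqI)
  then show ?thesis
    by (rule Bochner_Integration.integrable_cong[THEN iffD1, rotated -1]) (auto simp: indicator_def)
qed

text \<open>Bridge to the gauge integral, where additivity over intervals and the fundamental
  theorem of calculus are at hand.\<close>

lemma integral_indicator_lessThan:
  fixes f :: "real \<Rightarrow> real"
  assumes "integrable (lebesgue_on {0<..<L}) f" "x \<in> {0..L}"
  shows "f integrable_on {0..L}"
    "(\<integral>y. indicator {..<x} y * f y \<partial>lebesgue_on {0<..<L}) = integral {0..x} f"
proof -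
  show "f integrable_on {0..L}"
    using integrable_on_lebesgue_on[OF assms(1)] by (simp add: integrable_on_Icc_iff_Ioo)
  have "(\<integral>y. indicator {..<x} y * f y \<partial>lebesgue_on {0<..<L})
      = integral {0<..<L} (\<lambda>y. indicator {..<x} y * f y)"
    by (rule lebesgue_integral_eq_integral[OF integrable_indicator_lessThan[OF assms(1)]]) simp
  also have "\<dots> = integral {0<..<L} (\<lambda>y. if y \<in> {..<x} then f y else 0)"
    by (rule Henstock_Kurzweil_Integration.integral_cong) auto
  also have "\<dots> = integral ({..<x} \<inter> {0<..<L}) f"
    by (rule integral_restrict_Int)
  also have "{..<x} \<inter> {0<..<L} = {0<..<x}"
    using assms(2) by auto
  finally show "(\<integral>y. indicator {..<x} y * f y \<partial>lebesgue_on {0<..<L}) = integral {0..x} f"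
    by (simp add: integral_open_interval_real)
qed

lemma primitive_on_has_integral:
  assumes "primitive_on L F f" "0 \<le> a" "a \<le> b" "b \<le> L"
  shows "(f has_integral F b - F a) {a..b}"
proof -
  have int: "f integrable_on {0..L}"
    using assms integral_indicator_lessThan(1)[OF primitive_on_integrable, of L F f 0] by auto
  have F: "F x = F 0 + integral {0..x} f" if "x \<in> {0..L}" for x
    using primitive_on_eq[OF assms(1) that]
      integral_indicator_lessThan(2)[OF primitive_on_integrable[OF assms(1)] that] by simp
  have "f integrable_on {0..b}" "f integrable_on {a..b}"
    using int assms by (auto intro: integrable_on_subinterval)
  moreover from this have "integral {0..a} f + integral {a..b} f = integral {0..b} f"
    using assms by (intro Henstock_Kurzweil_Integration.integral_combine) auto
  ultimately show ?thesis
    using F[of a] F[of b] assms by (auto simp: has_integral_iff)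
qed

lemma primitive_on_integral:
  assumes "primitive_on L F f" "0 \<le> L"
  shows "(\<integral>x. f x \<partial>lebesgue_on {0<..<L}) = F L - F 0"
proof -
  have "(\<integral>x. f x \<partial>lebesgue_on {0<..<L}) = integral {0<..<L} f"
    using assms by (intro lebesgue_integral_eq_integral primitive_on_integrable) auto
  also have "\<dots> = F L - F 0"
    using integral_unique[OF primitive_on_has_integral[OF assms(1), of 0 L]] assms(2)
    by (simp add: integral_open_interval_real)
  finally show ?thesis .
qed

lemma primitive_onI:
  assumes "integrable (lebesgue_on {0<..<L}) f"
    and "\<And>x. x \<in> {0..L} \<Longrightarrow> (f has_integral F x - F 0) {0..x}"
  shows "primitive_on L F f"
  unfolding primitive_on_def
proof (intro conjI ballI assms(1))
  fix x assume x: "x \<in> {0..L}"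
  show "F x = F 0 + (\<integral>y. indicator {..<x} y * f y \<partial>lebesgue_on {0<..<L})"
    using integral_unique[OF assms(2)[OF x]] integral_indicator_lessThan(2)[OF assms(1) x] by simp
qed

lemma primitive_on_continuous:
  assumes "primitive_on L F f"
  shows "continuous_on {0..L} F"
proof -
  have *: "integrable (lebesgue_on {0<..<L}) f"
    using assms by (simp add: primitive_on_integrable)
  have "continuous_on {0..L} (\<lambda>x. F 0 + integral {0..x} f)"
  proof (cases "0 \<le> L")
    case True
    then show ?thesis
      using integral_indicator_lessThan(1)[OF *, of 0]
      by (intro continuous_intros indefinite_integral_continuous_1) auto
  qed auto
  then show ?thesis
  proof (rule continuous_on_eq)
    show "F 0 + integral {0..x} f = F x" if "x \<in> {0..L}" for x
      using primitive_on_eq[OF assms that] integral_indicator_lessThan(2)[OF * that] by simp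
  qed
qed

lemma integrable_continuous_mult:
  fixes f F :: "real \<Rightarrow> real"
  assumes F: "continuous_on {0..L} F" and f: "integrable (lebesgue_on {0<..<L}) f"
  shows "integrable (lebesgue_on {0<..<L}) (\<lambda>x. F x * f x)"
proof -
  have "compact (F ` {0..L})"
    using F by (intro compact_continuous_image) auto
  then obtain C where C: "\<And>x. x \<in> {0..L} \<Longrightarrow> \<bar>F x\<bar> \<le> C"
    using compact_imp_bounded[of "F ` {0..L}"] unfolding bounded_iff
    by (metis imageI real_norm_def)
  show ?thesis
  proof (rule Bochner_Integration.integrable_bound)
    show "integrable (lebesgue_on {0<..<L}) (\<lambda>x. C * f x)"
      using f by simp
    have "F \<in> borel_measurable (lebesgue_on {0<..<L})"
      by (rule continuous_imp_measurable_on_sets_lebesgue)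
        (auto intro: continuous_on_subset[OF F])
    then show "(\<lambda>x. F x * f x) \<in> borel_measurable (lebesgue_on {0<..<L})"
      using f by auto
    have "\<bar>F x\<bar> * \<bar>f x\<bar> \<le> \<bar>C\<bar> * \<bar>f x\<bar>" if "x \<in> {0<..<L}" for x
      using C[of x] that by (intro mult_right_mono) auto
    then show "AE x in lebesgue_on {0<..<L}. norm (F x * f x) \<le> norm (C * f x)"
      by (intro AE_I2) (auto simp: abs_mult)
  qed
qed

lemma integrable_continuous_Ioo:
  fixes F :: "real \<Rightarrow> real"
  assumes "continuous_on {0..L} F"
  shows "integrable (lebesgue_on {0<..<L}) F"
proof -
  have "integrable (lebesgue_on {0<..<L}) (\<lambda>x. 1 :: real)"
    by (rule finite_measure.integrable_const[OF finite_measure_lebesgue_on]) simp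
  from integrable_continuous_mult[OF assms this] show ?thesis
    by simp
qed

lemma primitive_on_measurable:
  assumes "primitive_on L F f"
  shows "F \<in> borel_measurable (lebesgue_on {0<..<L})"
  by (rule continuous_imp_measurable_on_sets_lebesgue)
    (auto intro: continuous_on_subset[OF primitive_on_continuous[OF assms]])

lemma primitive_on_cong:
  assumes "primitive_on L F f" "\<And>x. F x = G x" "\<And>x. f x = g x"
  shows "primitive_on L G g"
proof -
  have "F = G" "f = g"
    using assms(2,3) by auto
  then show ?thesis
    using assms(1) by simp
qed

lemma primitive_on_add:
  assumes "primitive_on L F f" "primitive_on L G g"
  shows "primitive_on L (\<lambda>x. F x + G x) (\<lambda>x. f x + g x)"
proof (rule primitive_onI)
  show "integrable (lebesgue_on {0<..<L}) (\<lambda>x. f x + g x)"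
    using assms by (simp add: primitive_on_integrable)
  fix x assume "x \<in> {0..L}"
  then show "((\<lambda>x. f x + g x) has_integral F x + G x - (F 0 + G 0)) {0..x}"
    using has_integral_add[OF primitive_on_has_integral[OF assms(1), of 0 x]
        primitive_on_has_integral[OF assms(2), of 0 x]]
    by (simp add: algebra_simps)
qed

lemma primitive_on_scale:
  assumes "primitive_on L F f"
  shows "primitive_on L (\<lambda>x. c * F x) (\<lambda>x. c * f x)"
proof (rule primitive_onI)
  show "integrable (lebesgue_on {0<..<L}) (\<lambda>x. c * f x)"
    using assms by (simp add: primitive_on_integrable)
  fix x assume "x \<in> {0..L}"
  then show "((\<lambda>x. c * f x) has_integral c * F x - c * F 0) {0..x}"
    using has_integral_mult_right[OF primitive_on_has_integral[OF assms(1), of 0 x], of c]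
    by (simp add: algebra_simps)
qed

lemma primitive_on_diff:
  assumes "primitive_on L F f" "primitive_on L G g"
  shows "primitive_on L (\<lambda>x. F x - G x) (\<lambda>x. f x - g x)"
  using primitive_on_add[OF assms(1) primitive_on_scale[OF assms(2), of "-1"]] by simp

lemma primitive_on_C1:
  assumes "\<And>x. (F has_real_derivative f x) (at x)" "continuous_on UNIV f"
  shows "primitive_on L F f"
proof (rule primitive_onI)
  show "integrable (lebesgue_on {0<..<L}) f"
    using assms(2) by (intro integrable_continuous_Ioo) (auto intro: continuous_on_subset)
  fix x assume "x \<in> {0..L}"
  then show "(f has_integral F x - F 0) {0..x}"
    using assms(1)
    by (intro fundamental_theorem_of_calculus)
      (auto simp: has_real_derivative_iff_has_vector_derivative intro: has_vector_derivative_at_within)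
qed

lemma primitive_on_id: "primitive_on L (\<lambda>x. x) (\<lambda>x. 1)"
  by (rule primitive_on_C1) (auto intro: derivative_eq_intros)

text \<open>Product rule for absolutely continuous functions. Neither factor need be differentiable
  everywhere, so the argument goes through Fubini: the square with corner (b,b) is cut along the
  diagonal into two triangles, each of which gives one of the two terms.\<close>

lemma primitive_on_mult:
  assumes F: "primitive_on L F f" and G: "primitive_on L G g"
  shows "primitive_on L (\<lambda>x. F x * G x) (\<lambda>x. F x * g x + G x * f x)"
proof -
  let ?M = "lebesgue_on {0<..<L}"
  interpret M: finite_measure ?M
    by (rule finite_measure_lebesgue_on) simp
  interpret P: pair_sigma_finite ?M ?M ..
  have f: "integrable ?M f" and g: "integrable ?M g"
    using F G by (auto simp: primitive_on_integrable)
  have [measurable]: "f \<in> borel_measurable ?M" "g \<in> borel_measurable ?M"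
    using f g by auto
  have [measurable]: "(\<lambda>x. x) \<in> borel_measurable ?M"
    by (rule continuous_imp_measurable_on_sets_lebesgue) (auto intro: continuous_intros)
  have pair: "integrable (?M \<Otimes>\<^sub>M ?M) (\<lambda>(y, z). indicator {(y, z). y < b \<and> z < y} (y, z) * (f y * g z))"
    if f: "integrable ?M f" and g: "integrable ?M g" for f g :: "real \<Rightarrow> real" and b
  proof (rule Bochner_Integration.integrable_bound)
    have [measurable]: "f \<in> borel_measurable ?M" "g \<in> borel_measurable ?M"
      using f g by auto
    show "integrable (?M \<Otimes>\<^sub>M ?M) (\<lambda>(y, z). f y * g z)"
      by (rule P.Fubini_integrable) (use f g in \<open>auto simp: abs_mult\<close>)
    show "(\<lambda>(y, z). indicator {(y, z). y < b \<and> z < y} (y, z) * (f y * g z)) \<in> borel_measurable (?M \<Otimes>\<^sub>M ?M)"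
    proof -
      have "(\<lambda>(y, z). (if y < b \<and> z < y then f y * g z else 0)) \<in> borel_measurable (?M \<Otimes>\<^sub>M ?M)"
        by measurable
      also have "(\<lambda>(y, z). (if y < b \<and> z < y then f y * g z else 0))
          = (\<lambda>(y, z). indicator {(y, z). y < b \<and> z < y} (y, z) * (f y * g z))"
        by (auto simp: fun_eq_iff)
      finally show ?thesis .
    qed
  qed (auto simp: indicator_def)
  have half: "(\<integral>y. indicator {..<b} y * (f y * (\<integral>z. indicator {..<y} z * g z \<partial>?M)) \<partial>?M)
      = (\<integral>y. (\<integral>z. indicator {(y, z). y < b \<and> z < y} (y, z) * (f y * g z) \<partial>?M) \<partial>?M)" for f g :: "real \<Rightarrow> real" and b
    by (intro Bochner_Integration.integral_cong refl)
      (simp flip: Bochner_Integration.integral_mult_right_zero,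
        intro Bochner_Integration.integral_cong, auto simp: indicator_def)
  \<comment> \<open>The left-hand side is the integral of f(y) g(z) over the triangle z < y < b
    plus, with the roles exchanged by Fubini, over y < z < b. Together they fill the square up to
    the diagonal.\<close>
  have fubini: "(\<integral>y. indicator {..<b} y * (f y * (\<integral>z. indicator {..<y} z * g z \<partial>?M)) \<partial>?M)
      + (\<integral>y. indicator {..<b} y * (g y * (\<integral>z. indicator {..<y} z * f z \<partial>?M)) \<partial>?M)
      = (\<integral>y. indicator {..<b} y * f y \<partial>?M) * (\<integral>z. indicator {..<b} z * g z \<partial>?M)" for b
  proof -
    let ?h = "\<lambda>y z. indicator {(y, z). y < b \<and> z < y} (y, z) :: real"
    have "(\<integral>y. (\<integral>z. ?h y z * (g y * f z) \<partial>?M) \<partial>?M) = (\<integral>y. (\<integral>z. ?h z y * (g z * f y) \<partial>?M) \<partial>?M)"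
      by (rule P.Fubini_integral[symmetric]) (use pair[OF g f] in auto)
    moreover have "(\<integral>y. (\<integral>z. ?h y z * (f y * g z) \<partial>?M) \<partial>?M) + (\<integral>y. (\<integral>z. ?h z y * (g z * f y) \<partial>?M) \<partial>?M)
        = (\<integral>y. (\<integral>z. ?h y z * (f y * g z) \<partial>?M) + (\<integral>z. ?h z y * (g z * f y) \<partial>?M) \<partial>?M)"
      by (rule Bochner_Integration.integral_add[symmetric])
        (use P.integrable_fst[OF pair[OF f g]] P.integrable_snd[OF pair[OF g f]] in auto)
    moreover have "\<dots> = (\<integral>y. (\<integral>z. (indicator {..<b} y * f y) * (indicator {..<b} z * g z) \<partial>?M) \<partial>?M)"
    proof (rule integral_cong_AE)
      show "(\<lambda>y. (\<integral>z. ?h y z * (f y * g z) \<partial>?M) + (\<integral>z. ?h z y * (g z * f y) \<partial>?M)) \<in> borel_measurable ?M"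
        using P.integrable_fst[OF pair[OF f g]] P.integrable_snd[OF pair[OF g f]] by auto
      show "(\<lambda>y. (\<integral>z. (indicator {..<b} y * f y) * (indicator {..<b} z * g z) \<partial>?M)) \<in> borel_measurable ?M"
        using integrable_indicator_lessThan[OF f] by simp
      have "AE y in ?M. integrable ?M (\<lambda>z. ?h y z * (f y * g z))"
        using P.AE_integrable_fst[OF pair[OF f g]] by simp
      moreover have "AE y in ?M. integrable ?M (\<lambda>z. ?h z y * (g z * f y))"
        using P.AE_integrable_snd[OF pair[OF g f]] by simp
      ultimately show "AE y in ?M. (\<integral>z. ?h y z * (f y * g z) \<partial>?M) + (\<integral>z. ?h z y * (g z * f y) \<partial>?M)
          = (\<integral>z. (indicator {..<b} y * f y) * (indicator {..<b} z * g z) \<partial>?M)"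
      proof eventually_elim
        case (elim y)
        then have "(\<integral>z. ?h y z * (f y * g z) \<partial>?M) + (\<integral>z. ?h z y * (g z * f y) \<partial>?M)
            = (\<integral>z. ?h y z * (f y * g z) + ?h z y * (g z * f y) \<partial>?M)"
          by simp
        also have "\<dots> = (\<integral>z. (indicator {..<b} y * f y) * (indicator {..<b} z * g z) \<partial>?M)"
        proof (rule integral_cong_AE)
          show "(\<lambda>z. ?h y z * (f y * g z) + ?h z y * (g z * f y)) \<in> borel_measurable ?M"
            using elim by auto
          show "(\<lambda>z. (indicator {..<b} y * f y) * (indicator {..<b} z * g z)) \<in> borel_measurable ?M"
            using integrable_indicator_lessThan[OF g] by auto
          \<comment> \<open>Each section of the missing diagonal is a single point, hence
            null.\<close>
          have "AE z in ?M. z \<noteq> y"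
            by (simp add: AE_restrict_space_iff) (rule AE_completion, rule AE_mp[OF AE_lborel_singleton], auto)
          then show "AE z in ?M. ?h y z * (f y * g z) + ?h z y * (g z * f y)
              = (indicator {..<b} y * f y) * (indicator {..<b} z * g z)"
            by eventually_elim (auto simp: indicator_def)
        qed
        finally show ?case .
      qed
    qed
    ultimately show ?thesis
      unfolding half by simp
  qed
  have int: "integrable ?M (\<lambda>x. F x * g x)" "integrable ?M (\<lambda>x. G x * f x)"
    using f g primitive_on_continuous[OF F] primitive_on_continuous[OF G]
    by (auto intro: integrable_continuous_mult)
  \<comment> \<open>Replacing F(y) by F(0) plus its integral turns F g into the iterated integrals
    treated by \<open>fubini\<close>.\<close>
  have expand: "(\<integral>y. indicator {..<x} y * (F y * g y) \<partial>?M) =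
      F 0 * (\<integral>y. indicator {..<x} y * g y \<partial>?M) +
      (\<integral>y. indicator {..<x} y * (g y * (\<integral>z. indicator {..<y} z * f z \<partial>?M)) \<partial>?M)"
    if F: "primitive_on L F f" and g: "integrable ?M g" for x and F f g :: "real \<Rightarrow> real"
  proof -
    have int: "integrable ?M (\<lambda>x. F x * g x)"
      using g primitive_on_continuous[OF F] by (auto intro: integrable_continuous_mult)
    have eq: "g y * (\<integral>z. indicator {..<y} z * f z \<partial>?M) = F y * g y - F 0 * g y" if "y \<in> {0<..<L}" for y
    proof -
      have "F y = F 0 + (\<integral>z. indicator {..<y} z * f z \<partial>?M)"
        using primitive_on_eq[OF F, of y] that by simp
      then show ?thesis by (simp add: algebra_simps)
    qed
    have "(\<integral>y. indicator {..<x} y * (g y * (\<integral>z. indicator {..<y} z * f z \<partial>?M)) \<partial>?M)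
        = (\<integral>y. indicator {..<x} y * (F y * g y) - F 0 * (indicator {..<x} y * g y) \<partial>?M)"
      by (intro Bochner_Integration.integral_cong refl) (simp add: eq, simp add: algebra_simps)
    also have "\<dots> = (\<integral>y. indicator {..<x} y * (F y * g y) \<partial>?M) - F 0 * (\<integral>y. indicator {..<x} y * g y \<partial>?M)"
      using integrable_indicator_lessThan[OF int] integrable_indicator_lessThan[OF g] by simp
    finally show ?thesis by simp
  qed
  show ?thesis
    unfolding primitive_on_def
  proof (intro conjI ballI)
    show "integrable ?M (\<lambda>x. F x * g x + G x * f x)"
      using int by simp
    fix x assume x: "x \<in> {0..L}"
    have "(\<integral>y. indicator {..<x} y * (F y * g y + G y * f y) \<partial>?M)
        = (\<integral>y. indicator {..<x} y * (F y * g y) + indicator {..<x} y * (G y * f y) \<partial>?M)"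
      by (simp add: algebra_simps)
    also have "\<dots> = (\<integral>y. indicator {..<x} y * (F y * g y) \<partial>?M) + (\<integral>y. indicator {..<x} y * (G y * f y) \<partial>?M)"
      by (intro Bochner_Integration.integral_add integrable_indicator_lessThan int)
    also have "\<dots> = F 0 * (\<integral>y. indicator {..<x} y * g y \<partial>?M) + G 0 * (\<integral>y. indicator {..<x} y * f y \<partial>?M)
        + (\<integral>y. indicator {..<x} y * f y \<partial>?M) * (\<integral>y. indicator {..<x} y * g y \<partial>?M)"
      unfolding expand[OF F g] expand[OF G f] using fubini[of x] by simp
    also have "\<dots> = F x * G x - F 0 * G 0"
      using primitive_on_eq[OF F x] primitive_on_eq[OF G x] by (simp add: algebra_simps)
    finally show "F x * G x = F 0 * G 0 + (\<integral>y. indicator {..<x} y * (F y * g y + G y * f y) \<partial>?M)"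
      by simp
  qed
qed

section \<open>The lemma of du Bois-Reymond\<close>

text \<open>The positive and negative parts of \<open>k\<close> are densities of two finite measures
  that agree on all rays, hence agree; uniqueness of densities then makes the two parts equal, and
  so both zero.\<close>

lemma AE_eq_0_if_integral_lessThan_eq_0:
  fixes k :: "real \<Rightarrow> real"
  assumes k: "integrable (lebesgue_on {0<..<L}) k"
    and zero: "\<And>x. x \<in> {0..L} \<Longrightarrow> (\<integral>y. indicator {..<x} y * k y \<partial>lebesgue_on {0<..<L}) = 0"
  shows "AE x in lebesgue_on {0<..<L}. k x = 0"
proof (cases "0 \<le> L")
  case False
  then have "{0<..<L} = {}" by auto
  then show ?thesis by (intro AE_I2) simp
next
  case True
  let ?M = "lebesgue_on {0<..<L}"
  let ?k = "\<lambda>x. indicator {0<..<L} x * k x"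
  have intk: "integrable lebesgue ?k"
    using k by (simp add: integrable_restrict_space)
  \<comment> \<open>\<open>k\<close> is only Lebesgue measurable, whereas the comparison of measures
    on rays takes place on Borel sets; hence a Borel representative of the extension by
    zero.\<close>
  then obtain k' where k' [measurable]: "k' \<in> borel_measurable borel" and kk': "AE x in lborel. ?k x = k' x"
    using completion_ex_borel_measurable_real[of ?k lborel] by auto
  have kk'c: "AE x in lebesgue. ?k x = k' x"
    using kk' by (rule AE_completion)
  have [measurable]: "k' \<in> borel_measurable lebesgue"
    by (rule measurable_completion) simp
  have intk': "integrable lborel k'"
  proof -
    have "integrable lebesgue k'"
      using intk kk'c by (subst integrable_cong_AE[symmetric, of ?k]) auto
    then show ?thesis by (simp add: integrable_completion)
  qed
  have zero_all: "(\<integral>y. indicator {..<x} y * k y \<partial>?M) = 0" for x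
  proof -
    consider "x \<in> {0..L}" | "x < 0" | "x > L" by fastforce
    then show ?thesis
    proof cases
      case 2
      then have "(\<integral>y. indicator {..<x} y * k y \<partial>?M) = (\<integral>y. 0 \<partial>?M)"
        by (intro Bochner_Integration.integral_cong) auto
      then show ?thesis by simp
    next
      case 3
      then have "(\<integral>y. indicator {..<x} y * k y \<partial>?M) = (\<integral>y. indicator {..<L} y * k y \<partial>?M)"
        by (intro Bochner_Integration.integral_cong) auto
      then show ?thesis using zero[of L] True by simp
    qed (use zero in auto)
  qed
  have integral_k': "(\<integral>y. h y * k' y \<partial>lborel) = (\<integral>y. h y * k y \<partial>?M)"
    if [measurable]: "h \<in> borel_measurable borel" for h
  proof -
    have [measurable]: "h \<in> borel_measurable lebesgue"
      by (rule measurable_completion) simp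
    have "(\<integral>y. h y * k' y \<partial>lborel) = (\<integral>y. h y * k' y \<partial>lebesgue)"
      by (rule integral_completion[symmetric]) simp
    also have "\<dots> = (\<integral>y. h y * ?k y \<partial>lebesgue)"
      by (rule integral_cong_AE) (use kk'c intk in auto)
    also have "\<dots> = (\<integral>y. indicator {0<..<L} y *\<^sub>R (h y * k y) \<partial>lebesgue)"
      by (simp add: mult.left_commute)
    finally show ?thesis
      by (simp add: integral_restrict_space)
  qed
  have zero_greater: "(\<integral>y. indicator {x<..} y * k' y \<partial>lborel) = 0" for x
  proof -
    have int: "integrable lborel (\<lambda>y. indicator {..<x} y * k' y)"
      using integrable_mult_indicator[of "{..<x}" lborel k'] intk' by simp
    \<comment> \<open>The comparison of measures uses upper rays, the hypothesis lower ones. The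
      total integral vanishes as well, and the point x left out by both rays is null.\<close>
    have "(\<integral>y. indicator {x<..} y * k' y \<partial>lborel) = (\<integral>y. k' y - indicator {..<x} y * k' y \<partial>lborel)"
    proof (rule integral_cong_AE)
      show "AE y in lborel. indicator {x<..} y * k' y = k' y - indicator {..<x} y * k' y"
        using AE_lborel_singleton[of x] by eventually_elim (auto simp: indicator_def)
    qed simp_all
    also have "\<dots> = (\<integral>y. 1 * k' y \<partial>lborel) - (\<integral>y. indicator {..<x} y * k' y \<partial>lborel)"
      using intk' int by simp
    also have "\<dots> = (\<integral>y. 1 * k y \<partial>?M) - (\<integral>y. indicator {..<x} y * k y \<partial>?M)"
      by (subst (1 2) integral_k') auto
    also have "(\<integral>y. 1 * k y \<partial>?M) = (\<integral>y. indicator {..<L} y * k y \<partial>?M)"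
      by (intro Bochner_Integration.integral_cong) auto
    finally show ?thesis
      unfolding zero_all by simp
  qed
  have dens: "emeasure (density lborel (\<lambda>y. ennreal (h y))) {x<..}
      = ennreal (\<integral>y. max 0 (indicator {x<..} y * h y) \<partial>lborel)" if h: "integrable lborel h" for h and x :: real
  proof -
    have [measurable]: "h \<in> borel_measurable borel"
      using h by auto
    have "emeasure (density lborel (\<lambda>y. ennreal (h y))) {x<..}
        = (\<integral>\<^sup>+ y. ennreal (h y) * indicator {x<..} y \<partial>lborel)"
      by (rule emeasure_density) auto
    also have "\<dots> = (\<integral>\<^sup>+ y. ennreal (max 0 (indicator {x<..} y * h y)) \<partial>lborel)"
      by (intro nn_integral_cong) (auto simp: indicator_def max_def ennreal_neg)
    also have "\<dots> = ennreal (\<integral>y. max 0 (indicator {x<..} y * h y) \<partial>lborel)"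
      using integrable_mult_indicator[of "{x<..}" lborel h] h
      by (intro nn_integral_eq_integral) (auto intro!: Bochner_Integration.integrable_max)
    finally show ?thesis .
  qed
  \<comment> \<open>\<open>ennreal\<close> sends negative numbers to 0, so the two densities are the
    positive and the negative part of \<open>k'\<close>.\<close>
  have "density lborel (\<lambda>y. ennreal (k' y)) = density lborel (\<lambda>y. ennreal (- k' y))"
  proof (rule measure_eqI_lessThan)
    fix x :: real
    show "emeasure (density lborel (\<lambda>y. ennreal (k' y))) {x<..} < \<infinity>"
      by (simp add: dens intk')
    have int: "integrable lborel (\<lambda>y. indicator {x<..} y * k' y)"
      using integrable_mult_indicator[of "{x<..}" lborel k'] intk' by simp
    have "0 = (\<integral>y. max 0 (indicator {x<..} y * k' y) - max 0 (indicator {x<..} y * - k' y) \<partial>lborel)"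
      by (subst zero_greater[of x, symmetric], rule Bochner_Integration.integral_cong) auto
    also have "\<dots> = (\<integral>y. max 0 (indicator {x<..} y * k' y) \<partial>lborel)
        - (\<integral>y. max 0 (indicator {x<..} y * - k' y) \<partial>lborel)"
      using int by (intro Bochner_Integration.integral_diff) (auto intro!: Bochner_Integration.integrable_max)
    finally show "emeasure (density lborel (\<lambda>y. ennreal (k' y))) {x<..}
        = emeasure (density lborel (\<lambda>y. ennreal (- k' y))) {x<..}"
      using intk' by (simp add: dens)
  qed auto
  then have "AE x in lborel. ennreal (k' x) = ennreal (- k' x)"
    by (subst (asm) sigma_finite_measure.density_unique_iff[OF lborel.sigma_finite_measure_axioms]) auto
  with kk' have "AE x in lborel. ?k x = 0"
    by eventually_elim (metis ennreal_eq_zero_iff ennreal_neg linorder_le_cases neg_0_le_iff_le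
        neg_equal_0_iff_equal)
  then have "AE x in lebesgue. ?k x = 0"
    by (rule AE_completion)
  then have "AE x in lebesgue. x \<in> {0<..<L} \<longrightarrow> k x = 0"
    by eventually_elim (auto simp: indicator_def)
  then show ?thesis
    by (simp add: AE_restrict_space_iff)
qed

section \<open>Test functions with prescribed derivative, and the conclusion for functions
  orthogonal to all such derivatives\<close>

text \<open>The integral of \<psi> from 0 is zero up to a because \<psi> is, and returns to zero at
  b because \<psi> has mean zero; this is what gives it compact support.\<close>

lemma test_function_antiderivative:
  assumes "0 < a" "b < L" "continuous_on UNIV \<psi>"
    and supp: "\<And>x. x \<notin> {a<..<b} \<Longrightarrow> \<psi> x = 0"
    and int: "(\<integral>x. \<psi> x \<partial>lebesgue_on {0<..<L}) = 0"
  obtains \<phi> where "test_function L \<phi>" "deriv \<phi> = \<psi>"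
proof (cases "a < b")
  case False
  then have "\<psi> = (\<lambda>x. 0)"
    using supp by auto
  then show ?thesis
    by (intro that[of "\<lambda>x. 0"]) (auto simp: test_function_def)
next
  case True
  define \<phi> where "\<phi> x = integral {0..x} \<psi>" for x
  have cont: "continuous_on S \<psi>" for S
    using assms(3) by (rule continuous_on_subset) simp
  have left: "\<phi> x = 0" if "x \<le> a" for x
  proof -
    have "\<phi> x = integral {0..x} (\<lambda>x. 0)"
      unfolding \<phi>_def by (rule Henstock_Kurzweil_Integration.integral_cong) (use that supp in auto)
    then show ?thesis by simp
  qed
  have "\<phi> b = (\<integral>y. indicator {..<b} y * \<psi> y \<partial>lebesgue_on {0<..<L})"
    unfolding \<phi>_def
  proof (rule integral_indicator_lessThan(2)[symmetric])
    show "integrable (lebesgue_on {0<..<L}) \<psi>"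
      by (rule integrable_continuous_Ioo[OF cont])
  qed (use assms True in auto)
  also have "\<dots> = (\<integral>x. \<psi> x \<partial>lebesgue_on {0<..<L})"
    by (intro Bochner_Integration.integral_cong refl) (use supp in \<open>auto simp: indicator_def\<close>)
  finally have phi_b: "\<phi> b = 0"
    using int by simp
  have right: "\<phi> x = 0" if "b \<le> x" for x
  proof -
    have "integral {0..b} \<psi> + integral {b..x} \<psi> = \<phi> x"
      unfolding \<phi>_def using True assms that
      by (intro Henstock_Kurzweil_Integration.integral_combine integrable_continuous_real cont) auto
    moreover have "integral {b..x} \<psi> = integral {b..x} (\<lambda>x. 0)"
      by (rule Henstock_Kurzweil_Integration.integral_cong) (use supp in auto)
    ultimately show ?thesis
      using phi_b by (simp add: \<phi>_def)
  qed
  have D: "(\<phi> has_real_derivative \<psi> x) (at x)" for x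
  \<comment> \<open>The integral is taken from 0, so the derivative rule applies only at positive x;
    to the left of a the function is locally zero.\<close>
  proof (cases "x < a")
    case True
    have "((\<lambda>x. 0) has_real_derivative \<psi> x) (at x)"
      using supp[of x] True by simp
    then show ?thesis
      by (rule has_field_derivative_transform_within_open[of _ _ _ "{..<a}"]) (use left True in auto)
  next
    case False
    then have x: "x \<in> {0<..<x+1}"
      using assms by auto
    have "((\<lambda>u. integral {0..u} \<psi>) has_real_derivative \<psi> x) (at x within {0..x+1})"
      using x by (intro integral_has_real_derivative cont) auto
    then have "((\<lambda>u. integral {0..u} \<psi>) has_real_derivative \<psi> x) (at x within {0<..<x+1})"
      by (rule DERIV_subset) auto
    then show ?thesis
      using x at_within_open[of x "{0<..<x+1}"] by (simp add: \<phi>_def[abs_def])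
  qed
  have sub: "closure {x. \<phi> x \<noteq> 0} \<subseteq> {a..b}"
  proof (rule closure_minimal)
    show "{x. \<phi> x \<noteq> 0} \<subseteq> {a..b}"
    proof
      fix x assume "x \<in> {x. \<phi> x \<noteq> 0}"
      then have "\<not> x \<le> a" "\<not> b \<le> x"
        using left[of x] right[of x] by auto
      then show "x \<in> {a..b}" by simp
    qed
  qed simp
  have "test_function L \<phi>"
    unfolding test_function_def
  proof (intro conjI)
    show "\<phi> C1_differentiable_on UNIV"
      unfolding C1_differentiable_on_def
      using D assms(3) has_real_derivative_iff_has_vector_derivative by blast
    show "compact (closure {x. \<phi> x \<noteq> 0})"
      using bounded_subset[OF bounded_closed_interval order_trans[OF closure_subset sub]] by simp
    show "closure {x. \<phi> x \<noteq> 0} \<subseteq> {0<..<L}"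
      using sub assms by auto
  qed
  moreover have "deriv \<phi> = \<psi>"
    using D by (auto intro: DERIV_imp_deriv)
  ultimately show ?thesis
    by (rule that)
qed

lemma continuous_approx_indicator:
  fixes x :: real
  assumes "0 < x"
  obtains w :: "nat \<Rightarrow> real \<Rightarrow> real" and a b where
    "\<And>n. continuous_on UNIV (w n)" "\<And>n y. \<bar>w n y\<bar> \<le> 1" "\<And>n. 0 < a n" "\<And>n. b n < x"
    "\<And>n y. y \<notin> {a n<..<b n} \<Longrightarrow> w n y = 0"
    "\<And>y. 0 < y \<Longrightarrow> (\<lambda>n. w n y) \<longlonglongrightarrow> indicat_real {..<x} y"
proof -
  define a where "a n = x / (real n + 2)" for n
  define b where "b n = x - a n" for n
  \<comment> \<open>A trapezoid of slope n cut off at height 1. A fixed y in (0,x) keeps a positive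
    distance from the ends of the support, so n times that distance eventually exceeds 1.\<close>
  define w where "w n y = max 0 (min 1 (real n * min (y - a n) (b n - y)))" for n y
  have a: "0 < a n" for n
    using assms by (simp add: a_def)
  have lim_a: "a \<longlonglongrightarrow> 0"
    unfolding a_def
    by (intro real_tendsto_divide_at_top[OF tendsto_const]
        filterlim_at_top_mono[OF filterlim_real_sequentially]) auto
  show ?thesis
  proof
    show "continuous_on UNIV (w n)" for n
      unfolding w_def by (intro continuous_intros)
    show "w n y = 0" if "y \<notin> {a n<..<b n}" for n y
    proof -
      have "min (y - a n) (b n - y) \<le> 0"
        using that by auto
      then have "real n * min (y - a n) (b n - y) \<le> 0"
        by (intro mult_nonneg_nonpos) auto
      then show ?thesis by (simp add: w_def)
    qed
    show "(\<lambda>n. w n y) \<longlonglongrightarrow> indicator {..<x} y" if "0 < y" for y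
    proof (cases "y < x")
      case True
      have "(\<lambda>n. min (y - a n) (b n - y)) \<longlonglongrightarrow> min (y - 0) (x - 0 - y)"
        unfolding b_def by (intro tendsto_intros lim_a)
      then have "filterlim (\<lambda>n. min (y - a n) (b n - y) * real n) at_top sequentially"
        by (rule filterlim_tendsto_pos_mult_at_top) (use that True in \<open>auto intro: filterlim_real_sequentially\<close>)
      then have "\<forall>\<^sub>F n in sequentially. min (y - a n) (b n - y) * real n \<ge> 1"
        by (simp add: filterlim_at_top)
      then have "\<forall>\<^sub>F n in sequentially. w n y = indicator {..<x} y"
        by eventually_elim (use True in \<open>simp add: w_def mult.commute\<close>)
      then show ?thesis
        by (rule tendsto_eventually)
    next
      case False
      have "w n y = 0" for n
        by (rule \<open>\<And>n y. y \<notin> {a n<..<b n} \<Longrightarrow> w n y = 0\<close>) (use False a[of n] in \<open>auto simp: b_def\<close>)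
      then show ?thesis using False by simp
    qed
  qed (use a in \<open>auto simp: b_def w_def\<close>)
qed

text \<open>
  Instead of mollifying, compare \<open>h\<close> on \<open>(0, x)\<close> and on \<open>(0, L)\<close>: if \<open>w\<close> and \<open>v\<close> are continuous
  approximations of the two indicators, then \<open>(\<integral>v) w - (\<integral>w) v\<close> has mean zero and so is the
  derivative of a test function.
\<close>

lemma du_Bois_Reymond:
  fixes h :: "real \<Rightarrow> real"
  assumes "0 < L" and h: "integrable (lebesgue_on {0<..<L}) h"
    and test: "\<And>\<phi>. test_function L \<phi> \<Longrightarrow> (\<integral>x. h x * deriv \<phi> x \<partial>lebesgue_on {0<..<L}) = 0"
  obtains c where "AE x in lebesgue_on {0<..<L}. h x = c"
proof -
  let ?M = "lebesgue_on {0<..<L}"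
  interpret M: finite_measure ?M
    by (rule finite_measure_lebesgue_on) simp
  \<comment> \<open>The mean of \<open>h\<close>. The next claim says that the primitive of
    \<open>h\<close> is linear, so \<open>h - C\<close> has zero primitive.\<close>
  define C where "C = (\<integral>x. h x \<partial>?M) / L"
  have scaled: "L * (\<integral>y. indicator {..<x} y * h y \<partial>?M) = x * (\<integral>y. h y \<partial>?M)" if x: "0 < x" "x \<le> L" for x
  proof -
    obtain w a b where w: "\<And>n. continuous_on UNIV (w n)" "\<And>n y. \<bar>w n y\<bar> \<le> 1" "\<And>n. 0 < a n" "\<And>n. b n < x"
      "\<And>n y. y \<notin> {a n<..<b n} \<Longrightarrow> w n y = 0"
      "\<And>y. 0 < y \<Longrightarrow> (\<lambda>n. w n y) \<longlonglongrightarrow> indicat_real {..<x} y"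
      by (rule continuous_approx_indicator[OF x(1)]) blast
    obtain v c d where v: "\<And>n. continuous_on UNIV (v n)" "\<And>n y. \<bar>v n y\<bar> \<le> 1" "\<And>n. 0 < c n" "\<And>n. d n < L"
      "\<And>n y. y \<notin> {c n<..<d n} \<Longrightarrow> v n y = 0"
      "\<And>y. 0 < y \<Longrightarrow> (\<lambda>n. v n y) \<longlonglongrightarrow> indicat_real {..<L} y"
      by (rule continuous_approx_indicator[OF \<open>0 < L\<close>]) blast
    have int: "integrable ?M (\<lambda>x. u x * f x)" if "continuous_on UNIV u" "integrable ?M f" for u f :: "real \<Rightarrow> real"
      by (rule integrable_continuous_mult) (use that in \<open>auto intro: continuous_on_subset\<close>)
    have lim: "(\<lambda>n. \<integral>y. u n y * f y \<partial>?M) \<longlonglongrightarrow> (\<integral>y. indicator {..<x} y * f y \<partial>?M)"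
      if f: "integrable ?M f" and u: "\<And>n. continuous_on UNIV (u n)" "\<And>n y. \<bar>u n y\<bar> \<le> 1"
      "\<And>y. 0 < y \<Longrightarrow> (\<lambda>n. u n y) \<longlonglongrightarrow> indicator {..<x} y"
      for u :: "nat \<Rightarrow> real \<Rightarrow> real" and f :: "real \<Rightarrow> real" and x
    proof (rule integral_dominated_convergence[where w = "\<lambda>x. norm (f x)"])
      show "integrable ?M (\<lambda>x. norm (f x))" using f by simp
      show "AE y in ?M. norm (u n y * f y) \<le> norm (f y)" for n
        using mult_right_mono[OF u(2)[of n]] by (intro AE_I2) (simp add: abs_mult)
      show "AE y in ?M. (\<lambda>n. u n y * f y) \<longlonglongrightarrow> indicator {..<x} y * f y"
        by (intro AE_I2 tendsto_intros u(3)) auto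
    qed (use integrable_indicator_lessThan[OF f] int[OF u(1) f] in auto)
    have "(\<integral>y. v n y * 1 \<partial>?M) * (\<integral>y. w n y * h y \<partial>?M) = (\<integral>y. w n y * 1 \<partial>?M) * (\<integral>y. v n y * h y \<partial>?M)" for n
    proof -
      let ?V = "\<integral>y. v n y * 1 \<partial>?M" and ?W = "\<integral>y. w n y * 1 \<partial>?M"
      define \<psi> where "\<psi> y = ?V * w n y - ?W * v n y" for y
      obtain \<phi> where \<phi>: "test_function L \<phi>" "deriv \<phi> = \<psi>"
      proof (rule test_function_antiderivative)
        \<comment> \<open>One interval containing both supports, still at positive distance from 0
          and L.\<close>
        show "0 < min (a n) (c n)" "max (b n) (d n) < L"
          using w(3)[of n] v(3)[of n] w(4)[of n] v(4)[of n] x by auto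
        show "continuous_on UNIV \<psi>"
          unfolding \<psi>_def by (intro continuous_intros w v)
        show "\<psi> y = 0" if "y \<notin> {min (a n) (c n)<..<max (b n) (d n)}" for y
        proof -
          have "y \<notin> {a n<..<b n}" "y \<notin> {c n<..<d n}"
            using that by (auto simp: min_def max_def split: if_splits)
          then show ?thesis
            using w(5) v(5) by (simp add: \<psi>_def)
        qed
        show "(\<integral>y. \<psi> y \<partial>?M) = 0"
          unfolding \<psi>_def using int[OF w(1), of "\<lambda>_. 1" n] int[OF v(1), of "\<lambda>_. 1" n] by simp
      qed
      have "0 = (\<integral>y. h y * \<psi> y \<partial>?M)"
        using test[OF \<phi>(1)] \<phi>(2) by simp
      also have "\<dots> = (\<integral>y. ?V * (w n y * h y) - ?W * (v n y * h y) \<partial>?M)"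
        by (simp add: \<psi>_def algebra_simps)
      also have "\<dots> = ?V * (\<integral>y. w n y * h y \<partial>?M) - ?W * (\<integral>y. v n y * h y \<partial>?M)"
        using int[OF w(1) h, of n] int[OF v(1) h, of n] by (subst Bochner_Integration.integral_diff) auto
      finally show ?thesis by simp
    qed
    moreover have "(\<lambda>n. (\<integral>y. v n y * 1 \<partial>?M) * (\<integral>y. w n y * h y \<partial>?M)) \<longlonglongrightarrow>
        (\<integral>y. indicator {..<L} y * 1 \<partial>?M) * (\<integral>y. indicator {..<x} y * h y \<partial>?M)"
      by (intro tendsto_mult lim h w v) auto
    moreover have "(\<lambda>n. (\<integral>y. w n y * 1 \<partial>?M) * (\<integral>y. v n y * h y \<partial>?M)) \<longlonglongrightarrow>
        (\<integral>y. indicator {..<x} y * 1 \<partial>?M) * (\<integral>y. indicator {..<L} y * h y \<partial>?M)"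
      by (intro tendsto_mult lim h w v) auto
    \<comment> \<open>Limit of the identity obtained by testing with \<phi>; the integrals of the
      two indicators are L and x.\<close>
    ultimately have "(\<integral>y. indicator {..<L} y * 1 \<partial>?M) * (\<integral>y. indicator {..<x} y * h y \<partial>?M)
        = (\<integral>y. indicator {..<x} y * 1 \<partial>?M) * (\<integral>y. indicator {..<L} y * h y \<partial>?M)"
      using LIMSEQ_unique by simp
    moreover have "(\<integral>y. indicator {..<u} y * 1 \<partial>?M) = u" if "0 < u" "u \<le> L" for u
      using integral_indicator_lessThan(2)[of L "\<lambda>_. 1" u] that by simp
    moreover have "(\<integral>y. indicator {..<L} y * h y \<partial>?M) = (\<integral>y. h y \<partial>?M)"
      by (rule Bochner_Integration.integral_cong) auto
    ultimately show ?thesis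
      using x \<open>0 < L\<close> by simp
  qed
  have "AE x in ?M. h x - C = 0"
  proof (rule AE_eq_0_if_integral_lessThan_eq_0)
    show "integrable ?M (\<lambda>x. h x - C)"
      using h by simp
    show "(\<integral>y. indicator {..<x} y * (h y - C) \<partial>?M) = 0" if x: "x \<in> {0..L}" for x
    proof -
      have "(\<integral>y. indicator {..<x} y * (h y - C) \<partial>?M)
          = (\<integral>y. indicator {..<x} y * h y - indicator {..<x} y * C \<partial>?M)"
        by (simp add: algebra_simps)
      also have "\<dots> = (\<integral>y. indicator {..<x} y * h y \<partial>?M) - (\<integral>y. indicator {..<x} y * C \<partial>?M)"
        by (intro Bochner_Integration.integral_diff integrable_indicator_lessThan h) auto
      also have "(\<integral>y. indicator {..<x} y * C \<partial>?M) = x * C"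
        using integral_indicator_lessThan(2)[of L "\<lambda>_. C" x] x by simp
      also have "(\<integral>y. indicator {..<x} y * h y \<partial>?M) = x * C"
      proof (cases "x = 0")
        case True
        then have "(\<integral>y. indicator {..<x} y * h y \<partial>?M) = (\<integral>y. 0 \<partial>?M)"
          by (intro Bochner_Integration.integral_cong) auto
        then show ?thesis using True by simp
      next
        case False
        then show ?thesis
          using scaled[of x] x \<open>0 < L\<close> by (simp add: C_def field_simps)
      qed
      finally show ?thesis by simp
    qed
  qed
  then show ?thesis
    by (intro that[of C]) auto
qed

section \<open>Weak derivatives and point values\<close>

lemma test_functionD:
  assumes "test_function L \<phi>"
  shows "(\<phi> has_real_derivative deriv \<phi> x) (at x)" "continuous_on UNIV (deriv \<phi>)"
    and "x \<notin> {0<..<L} \<Longrightarrow> \<phi> x = 0"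
proof -
  obtain D where D: "\<And>x. (\<phi> has_real_derivative D x) (at x)" "continuous_on UNIV D"
    using assms unfolding test_function_def C1_differentiable_on_def
    by (auto simp: has_real_derivative_iff_has_vector_derivative)
  then have "deriv \<phi> = D"
    by (auto intro: DERIV_imp_deriv)
  with D show "(\<phi> has_real_derivative deriv \<phi> x) (at x)" "continuous_on UNIV (deriv \<phi>)"
    by auto
  show "\<phi> x = 0" if "x \<notin> {0<..<L}"
    using assms closure_subset[of "{x. \<phi> x \<noteq> 0}"] that by (auto simp: test_function_def)
qed

lemma integrable_test_function_mult:
  assumes "f \<in> L2 L" "test_function L \<phi>"
  shows "integrable (lebesgue_on {0<..<L}) (\<lambda>x. f x * \<phi> x)"
    and "integrable (lebesgue_on {0<..<L}) (\<lambda>x. f x * deriv \<phi> x)"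
proof -
  have "continuous_on {0..L} \<phi>"
    by (rule DERIV_continuous_on, rule DERIV_subset[OF test_functionD(1)[OF assms(2)]]) simp
  moreover have "continuous_on {0..L} (deriv \<phi>)"
    using test_functionD(2)[OF assms(2)] by (rule continuous_on_subset) simp
  ultimately show "integrable (lebesgue_on {0<..<L}) (\<lambda>x. f x * \<phi> x)"
    "integrable (lebesgue_on {0<..<L}) (\<lambda>x. f x * deriv \<phi> x)"
    using integrable_continuous_mult[OF _ L2_integrable[OF assms(1)]]
    by (simp_all add: mult.commute[of "f _"])
qed

lemma is_weak_deriv_add:
  assumes "z \<in> L2 L" "w \<in> L2 L" "g \<in> L2 L" "h \<in> L2 L"
    and "is_weak_deriv L z g" "is_weak_deriv L w h"
  shows "is_weak_deriv L (\<lambda>x. z x + w x) (\<lambda>x. g x + h x)"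
  unfolding is_weak_deriv_def
proof (intro allI impI)
  fix \<phi> assume \<phi>: "test_function L \<phi>"
  let ?M = "lebesgue_on {0<..<L}"
  have "(\<integral>x. (z x + w x) * deriv \<phi> x \<partial>?M) = (\<integral>x. z x * deriv \<phi> x \<partial>?M) + (\<integral>x. w x * deriv \<phi> x \<partial>?M)"
    using assms \<phi> by (simp add: distrib_right integrable_test_function_mult)
  also have "\<dots> = - (\<integral>x. g x * \<phi> x \<partial>?M) - (\<integral>x. h x * \<phi> x \<partial>?M)"
    using assms(5,6) \<phi> by (simp add: is_weak_deriv_def)
  also have "\<dots> = - (\<integral>x. (g x + h x) * \<phi> x \<partial>?M)"
    using assms \<phi> by (simp add: distrib_right integrable_test_function_mult)
  finally show "(\<integral>x. (z x + w x) * deriv \<phi> x \<partial>?M) = - (\<integral>x. (g x + h x) * \<phi> x \<partial>?M)" .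
qed

lemma is_weak_deriv_scale:
  assumes "is_weak_deriv L z g"
  shows "is_weak_deriv L (\<lambda>x. c * z x) (\<lambda>x. c * g x)"
  using assms by (simp add: is_weak_deriv_def mult.assoc)

text \<open>If G is the integral of \<open>g\<close>, the product rule shows that G also has weak
  derivative \<open>g\<close>. Thus \<open>z - G\<close> is orthogonal to all derivatives of test
  functions and is constant almost everywhere.\<close>

lemma weak_deriv_primitive:
  assumes "0 < L" "z \<in> L2 L" "g \<in> L2 L" and weak: "is_weak_deriv L z g"
  obtains F where "primitive_on L F g" "AE x in lebesgue_on {0<..<L}. F x = z x"
proof -
  let ?M = "lebesgue_on {0<..<L}"
  define G where "G x = (\<integral>y. indicator {..<x} y * g y \<partial>?M)" for x
  have g: "integrable ?M g"
    using assms by (simp add: L2_integrable)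
  have G0: "G 0 = 0"
  proof -
    have "G 0 = (\<integral>y. 0 \<partial>?M)"
      unfolding G_def by (intro Bochner_Integration.integral_cong) auto
    then show ?thesis by simp
  qed
  have G: "primitive_on L G g"
    unfolding primitive_on_def G0 using g by (simp add: G_def)
  have intG: "integrable ?M G"
    by (rule integrable_continuous_Ioo[OF primitive_on_continuous[OF G]])
  obtain c where c: "AE x in ?M. z x - G x = c"
  proof (rule du_Bois_Reymond[OF \<open>0 < L\<close>])
    show "integrable ?M (\<lambda>x. z x - G x)"
      using assms intG by (simp add: L2_integrable)
    show "(\<integral>x. (z x - G x) * deriv \<phi> x \<partial>?M) = 0" if \<phi>: "test_function L \<phi>" for \<phi>
    proof -
      have "primitive_on L \<phi> (deriv \<phi>)"
        using test_functionD[OF \<phi>] by (intro primitive_on_C1) auto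
      from primitive_on_integral[OF primitive_on_mult[OF G this]]
      \<comment> \<open>No boundary terms remain, since \<phi> vanishes at 0 and L.\<close>
      have *: "(\<integral>x. G x * deriv \<phi> x + \<phi> x * g x \<partial>?M) = 0"
        using \<open>0 < L\<close> test_functionD(3)[OF \<phi>] by simp
      have int: "integrable ?M (\<lambda>x. G x * deriv \<phi> x)"
        using integrable_continuous_mult[OF continuous_on_subset[OF test_functionD(2)[OF \<phi>]] intG]
        by (simp add: mult.commute)
      have "(\<integral>x. (z x - G x) * deriv \<phi> x \<partial>?M) = (\<integral>x. z x * deriv \<phi> x \<partial>?M) - (\<integral>x. G x * deriv \<phi> x \<partial>?M)"
        using int assms \<phi> by (simp add: left_diff_distrib integrable_test_function_mult)
      also have "(\<integral>x. z x * deriv \<phi> x \<partial>?M) = - (\<integral>x. g x * \<phi> x \<partial>?M)"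
        using weak \<phi> by (simp add: is_weak_deriv_def)
      also have "(\<integral>x. G x * deriv \<phi> x \<partial>?M) = - (\<integral>x. g x * \<phi> x \<partial>?M)"
        using * int integrable_test_function_mult(1)[OF assms(3) \<phi>] by (simp add: mult.commute)
      finally show ?thesis by simp
    qed
  qed
  show ?thesis
  proof
    show "primitive_on L (\<lambda>x. G x + c) g"
      using G0 g by (simp add: primitive_on_def G_def)
    show "AE x in ?M. G x + c = z x"
      using c by eventually_elim auto
  qed
qed

text \<open>The points of (0,L) where the functions differ form an open null set, which is empty;
  the endpoints follow by continuity.\<close>

lemma continuous_AE_eq_imp_eq:
  fixes F G :: "real \<Rightarrow> real"
  assumes "0 < L" "continuous_on {0..L} F" "continuous_on {0..L} G"
    and "AE x in lebesgue_on {0<..<L}. F x = G x" "x \<in> {0..L}"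
  shows "F x = G x"
proof -
  let ?h = "\<lambda>x. F x - G x"
  define U where "U = {0<..<L} \<inter> ?h -` (- {0})"
  have "open U"
    unfolding U_def by (rule continuous_open_preimage)
      (auto intro!: continuous_intros continuous_on_subset[OF assms(2)] continuous_on_subset[OF assms(3)])
  moreover have "AE x in lebesgue. x \<notin> U"
    using assms(4) by (auto simp: AE_restrict_space_iff U_def elim: eventually_mono)
  then have "U \<in> null_sets lebesgue"
    using \<open>open U\<close> by (subst AE_iff_null_sets) auto
  ultimately have "U = {}"
    using open_not_negligible negligible_iff_null_sets by blast
  then have "?h y = 0" if "y \<in> {0<..<L}" for y
    using that by (auto simp: U_def)
  then have "?h x = 0"
    by (rule continuous_constant_on_closure[of "{0<..<L}" ?h, rotated])
      (use assms in \<open>auto intro!: continuous_intros\<close>)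
  then show ?thesis by simp
qed

text \<open>The difference \<open>g - h\<close> is a weak derivative of 0, so it has a primitive
  that is continuous and zero almost everywhere, hence zero on all of [0,L].\<close>

lemma weak_deriv_unique:
  assumes "0 < L" "z \<in> L2 L" "g \<in> L2 L" "h \<in> L2 L" "is_weak_deriv L z g" "is_weak_deriv L z h"
  shows "AE x in lebesgue_on {0<..<L}. g x = h x"
proof -
  have "is_weak_deriv L (\<lambda>x. z x + -1 * z x) (\<lambda>x. g x + -1 * h x)"
    using assms by (intro is_weak_deriv_add is_weak_deriv_scale L2_scale)
  then have "is_weak_deriv L (\<lambda>x. 0) (\<lambda>x. g x - h x)"
    by simp
  then obtain F where F: "primitive_on L F (\<lambda>x. g x - h x)" "AE x in lebesgue_on {0<..<L}. F x = 0"
    using weak_deriv_primitive[OF assms(1) L2_zero L2_diff[OF assms(3,4)]] by auto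
  have F0: "F x = 0" if "x \<in> {0..L}" for x
    by (rule continuous_AE_eq_imp_eq[OF assms(1) primitive_on_continuous[OF F(1)] _ F(2) that]) simp
  have "AE x in lebesgue_on {0<..<L}. g x - h x = 0"
  proof (rule AE_eq_0_if_integral_lessThan_eq_0[OF primitive_on_integrable[OF F(1)]])
    show "(\<integral>y. indicator {..<x} y * (g y - h y) \<partial>lebesgue_on {0<..<L}) = 0" if "x \<in> {0..L}" for x
      using primitive_on_eq[OF F(1) that] F0[OF that] F0[of 0] \<open>0 < L\<close> by simp
  qed
  then show ?thesis by simp
qed

lemma H1_L2: "z \<in> H1 L \<Longrightarrow> z \<in> L2 L"
  by (simp add: H1_def)

lemma H1_wderiv:
  assumes "z \<in> H1 L"
  shows "wderiv L z \<in> L2 L" "is_weak_deriv L z (wderiv L z)"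
proof -
  have "\<exists>g. g \<in> L2 L \<and> is_weak_deriv L z g"
    using assms by (auto simp: H1_def)
  from someI_ex[OF this] show "wderiv L z \<in> L2 L" "is_weak_deriv L z (wderiv L z)"
    by (auto simp: wderiv_def)
qed

lemma H1I: "z \<in> L2 L \<Longrightarrow> g \<in> L2 L \<Longrightarrow> is_weak_deriv L z g \<Longrightarrow> z \<in> H1 L"
  by (auto simp: H1_def)

lemma H1_scale: "z \<in> H1 L \<Longrightarrow> (\<lambda>x. c * z x) \<in> H1 L"
  by (rule H1I[OF L2_scale[OF H1_L2] L2_scale[OF H1_wderiv(1)] is_weak_deriv_scale[OF H1_wderiv(2)]])

text \<open>Because \<open>wderiv\<close> is a choice of representative, its linearity holds only up
  to null sets; the same goes for \<open>wderiv_diff\<close>.\<close>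

lemma wderiv_scale:
  assumes "0 < L" "z \<in> H1 L"
  shows "AE x in lebesgue_on {0<..<L}. wderiv L (\<lambda>x. c * z x) x = c * wderiv L z x"
  using weak_deriv_unique[OF assms(1) L2_scale[OF H1_L2] _ _ _ is_weak_deriv_scale]
    H1_wderiv[OF H1_scale[OF assms(2)]] L2_scale H1_wderiv[OF assms(2)] assms(2) by blast

lemma H1_diff:
  assumes "z \<in> H1 L" "w \<in> H1 L"
  shows "(\<lambda>x. z x - w x) \<in> H1 L"
    and "is_weak_deriv L (\<lambda>x. z x - w x) (\<lambda>x. wderiv L z x - wderiv L w x)"
proof -
  have "is_weak_deriv L (\<lambda>x. z x + -1 * w x) (\<lambda>x. wderiv L z x + -1 * wderiv L w x)"
    by (intro is_weak_deriv_add H1_L2[OF assms(1)] L2_scale[OF H1_L2[OF assms(2)]] H1_wderiv[OF assms(1)]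
        L2_scale[OF H1_wderiv(1)[OF assms(2)]] is_weak_deriv_scale[OF H1_wderiv(2)[OF assms(2)]])
  then show "is_weak_deriv L (\<lambda>x. z x - w x) (\<lambda>x. wderiv L z x - wderiv L w x)"
    by simp
  then show "(\<lambda>x. z x - w x) \<in> H1 L"
    by (rule H1I[OF L2_diff L2_diff, rotated -1]) (use assms in \<open>auto intro: H1_L2 H1_wderiv\<close>)
qed

lemma wderiv_diff:
  assumes "0 < L" "z \<in> H1 L" "w \<in> H1 L"
  shows "AE x in lebesgue_on {0<..<L}. wderiv L (\<lambda>x. z x - w x) x = wderiv L z x - wderiv L w x"
  by (rule weak_deriv_unique[OF assms(1) _ _ _ H1_wderiv(2) H1_diff(2)])
    (use assms H1_diff(1)[OF assms(2,3)] in \<open>auto intro: H1_L2 H1_wderiv L2_diff\<close>)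

text \<open>This makes integration by parts available for members of \<open>H1\<close>: the boundary
  terms that it produces are exactly the point values in the boundary conditions.\<close>

lemma point_value_primitive:
  assumes "0 < L" "z \<in> H1 L"
  shows "primitive_on L (point_value L z) (wderiv L z)"
    and "AE x in lebesgue_on {0<..<L}. point_value L z x = z x"
proof -
  obtain F where F: "primitive_on L F (wderiv L z)" "AE x in lebesgue_on {0<..<L}. F x = z x"
    using weak_deriv_primitive[OF assms(1) H1_L2 H1_wderiv] assms(2) by blast
  have "\<exists>c. continuous_on {0..L} c \<and> (AE x in lebesgue_on {0<..<L}. c x = z x)"
    using F primitive_on_continuous by blast
  from someI_ex[OF this] have pv: "continuous_on {0..L} (point_value L z)"
    and *: "AE x in lebesgue_on {0<..<L}. point_value L z x = z x"
    by (auto simp: point_value_def)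
  show "AE x in lebesgue_on {0<..<L}. point_value L z x = z x" by fact
  have "AE x in lebesgue_on {0<..<L}. point_value L z x = F x"
    using * F(2) by eventually_elim simp
  then have eq: "point_value L z x = F x" if "x \<in> {0..L}" for x
    using continuous_AE_eq_imp_eq[OF assms(1) pv primitive_on_continuous[OF F(1)] _ that] by simp
  show "primitive_on L (point_value L z) (wderiv L z)"
    unfolding primitive_on_def
  proof (intro conjI ballI primitive_on_integrable[OF F(1)])
    show "point_value L z x = point_value L z 0
        + (\<integral>y. indicator {..<x} y * wderiv L z y \<partial>lebesgue_on {0<..<L})" if "x \<in> {0..L}" for x
      using primitive_on_eq[OF F(1) that] eq[OF that] eq[of 0] assms(1) by simp
  qed
qed

text \<open>Equality holds as functions, even outside [0,L], because the predicates under the choice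
  operator are equivalent.\<close>

lemma point_value_cong_AE:
  assumes "AE x in lebesgue_on {0<..<L}. z x = w x"
  shows "point_value L z = point_value L w"
proof -
  have "(AE x in lebesgue_on {0<..<L}. c x = z x) \<longleftrightarrow> (AE x in lebesgue_on {0<..<L}. c x = w x)" for c
  proof
    assume "AE x in lebesgue_on {0<..<L}. c x = z x"
    with assms show "AE x in lebesgue_on {0<..<L}. c x = w x"
      by eventually_elim simp
  next
    assume "AE x in lebesgue_on {0<..<L}. c x = w x"
    with assms show "AE x in lebesgue_on {0<..<L}. c x = z x"
      by eventually_elim simp
  qed
  then show ?thesis
    by (simp add: point_value_def fun_eq_iff)
qed

section \<open>Differentiable curves in $L^2$\<close>

lemma at_within_nonneg_neq_bot: "0 \<le> t \<Longrightarrow> at t within {0..} \<noteq> bot" for t :: real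
proof -
  assume "0 \<le> t"
  then have "at_right t \<le> at t within {0..}"
    by (intro at_le) auto
  then show ?thesis
    using trivial_limit_at_right_real[of t] by (metis bot.extremum_uniqueI)
qed

lemma eventually_nonneg_at_within: "\<forall>\<^sub>F s in at t within {0..}. 0 \<le> s \<and> s \<noteq> t" for t :: real
  by (auto simp: eventually_at_filter)

abbreviation has_L2_deriv :: "real \<Rightarrow> (real \<Rightarrow> real \<Rightarrow> real) \<Rightarrow> real \<Rightarrow> (real \<Rightarrow> real) \<Rightarrow> bool" where
  "has_L2_deriv L \<equiv> has_curve_deriv (L2 L) (L2_norm L)"

lemma has_L2_deriv_unique:
  assumes u: "\<And>s. 0 \<le> s \<Longrightarrow> u s \<in> L2 L" and t: "0 \<le> t"
    and d: "has_L2_deriv L u t d" and e: "has_L2_deriv L u t e"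
  shows "AE x in lebesgue_on {0<..<L}. d x = e x"
proof -
  let ?Q = "\<lambda>s x. (u s x - u t x) / (s - t)"
  have L2: "d \<in> L2 L" "e \<in> L2 L"
    using d e by (auto simp: has_curve_deriv_def)
  have "((\<lambda>s. L2_norm L (\<lambda>x. ?Q s x - e x) + L2_norm L (\<lambda>x. ?Q s x - d x)) \<longlongrightarrow> 0 + 0) (at t within {0..})"
    using d e by (intro tendsto_add) (auto simp: has_curve_deriv_def)
  moreover have "\<forall>\<^sub>F s in at t within {0..}. L2_norm L (\<lambda>x. d x - e x)
      \<le> L2_norm L (\<lambda>x. ?Q s x - e x) + L2_norm L (\<lambda>x. ?Q s x - d x)"
    using eventually_nonneg_at_within[of t]
  proof eventually_elim
    case (elim s)
    then have Q: "?Q s \<in> L2 L"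
      using u[of s] u[of t] t by (intro L2_divide L2_diff) auto
    have "L2_norm L (\<lambda>x. d x - e x) = L2_norm L (\<lambda>x. (?Q s x - e x) + -1 * (?Q s x - d x))"
      by simp
    also have "\<dots> \<le> L2_norm L (\<lambda>x. ?Q s x - e x) + L2_norm L (\<lambda>x. -1 * (?Q s x - d x))"
      using Q L2 by (intro L2_norm_triangle L2_scale L2_diff)
    also have "L2_norm L (\<lambda>x. -1 * (?Q s x - d x)) = L2_norm L (\<lambda>x. ?Q s x - d x)"
      by (subst L2_norm_scale) simp
    finally show ?case .
  qed
  ultimately have "L2_norm L (\<lambda>x. d x - e x) \<le> 0 + 0"
    by (intro tendsto_lowerbound[OF _ _ at_within_nonneg_neq_bot[OF t]])
  then have "L2_norm L (\<lambda>x. d x - e x) = 0"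
    using L2_norm_nonneg[of L "\<lambda>x. d x - e x"] by linarith
  then show ?thesis
    using L2_norm_eq_0_AE[OF L2_diff[OF L2]] by simp
qed

text \<open>Needed because \<open>tderiv\<close> picks a representative at each time independently;
  differentiability of the curve must not depend on these picks.\<close>

lemma has_L2_deriv_cong_AE:
  assumes u: "\<And>s. 0 \<le> s \<Longrightarrow> u s \<in> L2 L" and w: "\<And>s. 0 \<le> s \<Longrightarrow> w s \<in> L2 L"
    and uw: "\<And>s. 0 \<le> s \<Longrightarrow> AE x in lebesgue_on {0<..<L}. u s x = w s x"
    and de: "AE x in lebesgue_on {0<..<L}. d x = e x" "e \<in> L2 L"
    and t: "0 \<le> t" and d: "has_L2_deriv L u t d"
  shows "has_L2_deriv L w t e"
  unfolding has_curve_deriv_def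
proof
  have L2: "d \<in> L2 L"
    using d by (auto simp: has_curve_deriv_def)
  have "((\<lambda>s. L2_norm L (\<lambda>x. (u s x - u t x) / (s - t) - d x)) \<longlongrightarrow> 0) (at t within {0..})"
    using d by (simp add: has_curve_deriv_def)
  moreover have "\<forall>\<^sub>F s in at t within {0..}. L2_norm L (\<lambda>x. (u s x - u t x) / (s - t) - d x)
      = L2_norm L (\<lambda>x. (w s x - w t x) / (s - t) - e x)"
    using eventually_nonneg_at_within[of t]
  proof eventually_elim
    case (elim s)
    show ?case
    proof (rule L2_norm_cong_AE)
      show "AE x in lebesgue_on {0<..<L}. (u s x - u t x) / (s - t) - d x = (w s x - w t x) / (s - t) - e x"
        using uw[of s, OF conjunct1[OF elim]] uw[OF t] de(1) by eventually_elim simp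
    qed (use elim t u w L2 de in \<open>auto intro!: L2_diff L2_divide\<close>)
  qed
  ultimately show "((\<lambda>s. L2_norm L (\<lambda>x. (w s x - w t x) / (s - t) - e x)) \<longlongrightarrow> 0) (at t within {0..})"
    by (rule Lim_transform_eventually)
qed (use de in simp)

lemma tderiv_has_L2_deriv:
  assumes "has_L2_deriv L u t d"
  shows "has_L2_deriv L u t (tderiv L u t)"
  unfolding tderiv_def using assms by (rule someI[of "has_L2_deriv L u t"])

lemma has_L2_deriv_imp_L2: "has_L2_deriv L u t d \<Longrightarrow> d \<in> L2 L"
  by (simp add: has_curve_deriv_def)

lemma has_L2_deriv_tendsto:
  assumes u: "\<And>s. 0 \<le> s \<Longrightarrow> u s \<in> L2 L" and t: "0 \<le> t" and d: "has_L2_deriv L u t d"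
  shows "((\<lambda>s. L2_norm L (\<lambda>x. u s x - u t x)) \<longlongrightarrow> 0) (at t within {0..})"
proof (rule Lim_null_comparison)
  let ?Q = "\<lambda>s x. (u s x - u t x) / (s - t)"
  have L2: "d \<in> L2 L"
    using d by (auto simp: has_curve_deriv_def)
  show "\<forall>\<^sub>F s in at t within {0..}. norm (L2_norm L (\<lambda>x. u s x - u t x))
      \<le> \<bar>s - t\<bar> * (L2_norm L (\<lambda>x. ?Q s x - d x) + L2_norm L d)"
    using eventually_nonneg_at_within[of t]
  proof eventually_elim
    case (elim s)
    then have Q: "?Q s \<in> L2 L"
      using u[of s] u[of t] t by (intro L2_divide L2_diff) auto
    have "L2_norm L (\<lambda>x. u s x - u t x) = L2_norm L (\<lambda>x. (s - t) * ((?Q s x - d x) + d x))"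
      using elim by (intro arg_cong[where f = "L2_norm L"]) (auto simp: fun_eq_iff)
    also have "\<dots> = \<bar>s - t\<bar> * L2_norm L (\<lambda>x. (?Q s x - d x) + d x)"
      by (rule L2_norm_scale)
    also have "\<dots> \<le> \<bar>s - t\<bar> * (L2_norm L (\<lambda>x. ?Q s x - d x) + L2_norm L d)"
      using Q L2 by (intro mult_left_mono L2_norm_triangle L2_diff) auto
    finally show ?case by simp
  qed
  have "((\<lambda>s. \<bar>s - t\<bar> * (L2_norm L (\<lambda>x. ?Q s x - d x) + L2_norm L d)) \<longlongrightarrow> \<bar>t - t\<bar> * (0 + L2_norm L d))
      (at t within {0..})"
    using d by (intro tendsto_intros) (auto simp: has_curve_deriv_def)
  then show "((\<lambda>s. \<bar>s - t\<bar> * (L2_norm L (\<lambda>x. ?Q s x - d x) + L2_norm L d)) \<longlongrightarrow> 0) (at t within {0..})"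
    by simp
qed

text \<open>The quotient of the inner product splits as <Q_s, w_s> + <u_t, R_s> with the quotients Q
  of \<open>u\<close> and R of \<open>w\<close>. The first term also needs w_s to tend to w_t, which
  differentiability provides.\<close>

lemma has_L2_deriv_inner:
  assumes u: "\<And>s. 0 \<le> s \<Longrightarrow> u s \<in> L2 L" and w: "\<And>s. 0 \<le> s \<Longrightarrow> w s \<in> L2 L"
    and t: "0 \<le> t" and d: "has_L2_deriv L u t d" and e: "has_L2_deriv L w t e"
  shows "((\<lambda>s. \<integral>x. u s x * w s x \<partial>lebesgue_on {0<..<L}) has_real_derivative
      (\<integral>x. d x * w t x + u t x * e x \<partial>lebesgue_on {0<..<L})) (at t within {0..})"
  unfolding has_field_derivative_iff
proof -
  let ?F = "at t within {0..}" and ?M = "lebesgue_on {0<..<L}"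
  let ?Q = "\<lambda>s x. (u s x - u t x) / (s - t)" and ?R = "\<lambda>s x. (w s x - w t x) / (s - t)"
  have L2: "d \<in> L2 L" "e \<in> L2 L" "u t \<in> L2 L" "w t \<in> L2 L"
    using d e u w t by (auto simp: has_curve_deriv_def)
  have ev: "\<forall>\<^sub>F s in ?F. u s \<in> L2 L \<and> w s \<in> L2 L \<and> ?Q s \<in> L2 L \<and> ?R s \<in> L2 L \<and> s \<noteq> t"
    using eventually_nonneg_at_within[of t]
    by eventually_elim (use u w t in \<open>auto intro!: L2_diff L2_divide\<close>)
  have "((\<lambda>s. \<integral>x. ?Q s x * w s x \<partial>?M) \<longlongrightarrow> (\<integral>x. d x * w t x \<partial>?M)) ?F"
    using d has_L2_deriv_tendsto[OF w t e] L2 ev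
    by (intro L2_integral_mult_tendsto) (auto simp: has_curve_deriv_def elim: eventually_mono)
  moreover have "((\<lambda>s. \<integral>x. u t x * ?R s x \<partial>?M) \<longlongrightarrow> (\<integral>x. u t x * e x \<partial>?M)) ?F"
  proof (rule L2_integral_mult_tendsto)
    show "\<forall>\<^sub>F s in ?F. ?R s \<in> L2 L"
      using ev by eventually_elim simp
    have "L2_norm L (\<lambda>x. 0) = 0"
      by (simp add: L2_norm_def)
    then show "((\<lambda>s. L2_norm L (\<lambda>x. u t x - u t x)) \<longlongrightarrow> 0) ?F"
      by simp
  qed (use e L2 in \<open>auto simp: has_curve_deriv_def\<close>)
  ultimately have lim: "((\<lambda>s. (\<integral>x. ?Q s x * w s x \<partial>?M) + (\<integral>x. u t x * ?R s x \<partial>?M)) \<longlongrightarrow>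
      (\<integral>x. d x * w t x \<partial>?M) + (\<integral>x. u t x * e x \<partial>?M)) ?F"
    by (rule tendsto_add)
  have sum: "(\<integral>x. d x * w t x \<partial>?M) + (\<integral>x. u t x * e x \<partial>?M) = (\<integral>x. d x * w t x + u t x * e x \<partial>?M)"
    by (simp add: L2_integrable_mult L2)
  have "\<forall>\<^sub>F s in ?F. (\<integral>x. ?Q s x * w s x \<partial>?M) + (\<integral>x. u t x * ?R s x \<partial>?M)
      = ((\<integral>x. u s x * w s x \<partial>?M) - (\<integral>x. u t x * w t x \<partial>?M)) / (s - t)"
    using ev
  proof eventually_elim
    case (elim s)
    then have "(\<integral>x. ?Q s x * w s x \<partial>?M) + (\<integral>x. u t x * ?R s x \<partial>?M)
        = (\<integral>x. ?Q s x * w s x + u t x * ?R s x \<partial>?M)"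
      using L2 by (intro Bochner_Integration.integral_add[symmetric] L2_integrable_mult) auto
    also have "\<dots> = (\<integral>x. (u s x * w s x - u t x * w t x) / (s - t) \<partial>?M)"
      by (intro Bochner_Integration.integral_cong refl)
        (simp add: diff_divide_distrib algebra_simps)
    also have "\<dots> = (\<integral>x. u s x * w s x - u t x * w t x \<partial>?M) / (s - t)"
      by simp
    also have "(\<integral>x. u s x * w s x - u t x * w t x \<partial>?M) = (\<integral>x. u s x * w s x \<partial>?M) - (\<integral>x. u t x * w t x \<partial>?M)"
      using elim L2 by (intro Bochner_Integration.integral_diff L2_integrable_mult) auto
    finally show ?case .
  qed
  with lim show "((\<lambda>s. ((\<integral>x. u s x * w s x \<partial>?M) - (\<integral>x. u t x * w t x \<partial>?M)) / (s - t)) \<longlongrightarrow>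
      (\<integral>x. d x * w t x + u t x * e x \<partial>?M)) ?F"
    unfolding sum by (rule Lim_transform_eventually)
qed

lemma L2_weight:
  assumes "f \<in> L2 L"
  shows "(\<lambda>x. x * f x) \<in> L2 L" "L2_norm L (\<lambda>x. x * f x) \<le> \<bar>L\<bar> * L2_norm L f"
proof -
  let ?M = "lebesgue_on {0<..<L}"
  have [measurable]: "(\<lambda>x. x) \<in> borel_measurable ?M"
    by (rule continuous_imp_measurable_on_sets_lebesgue) (auto intro: continuous_intros)
  have [measurable]: "f \<in> borel_measurable ?M"
    using assms by (rule L2_measurable)
  have bound: "(x * f x)\<^sup>2 \<le> (L * f x)\<^sup>2" if "x \<in> {0<..<L}" for x
    using that by (auto simp: power_mult_distrib intro!: mult_right_mono power_mono)
  have int: "integrable ?M (\<lambda>x. (L * f x)\<^sup>2)"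
    using L2_integrable_square[OF L2_scale[OF assms, of L]] .
  have int': "integrable ?M (\<lambda>x. (x * f x)\<^sup>2)"
    by (rule Bochner_Integration.integrable_bound[OF int]) (use bound in auto)
  show "(\<lambda>x. x * f x) \<in> L2 L"
    using int' by (auto simp: L2_def)
  have "L2_norm L (\<lambda>x. x * f x) \<le> L2_norm L (\<lambda>x. L * f x)"
    unfolding L2_norm_def
    by (intro real_sqrt_le_mono integral_mono int int') (use bound in auto)
  then show "L2_norm L (\<lambda>x. x * f x) \<le> \<bar>L\<bar> * L2_norm L f"
    by (simp only: L2_norm_scale)
qed

text \<open>Multiplication by x is a bounded linear operator on \<open>L2\<close>, so it commutes
  with time differentiation.\<close>

lemma has_L2_deriv_weight:
  assumes u: "\<And>s. 0 \<le> s \<Longrightarrow> u s \<in> L2 L" and t: "0 \<le> t" and d: "has_L2_deriv L u t d"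
  shows "has_L2_deriv L (\<lambda>s x. x * u s x) t (\<lambda>x. x * d x)"
  unfolding has_curve_deriv_def
proof
  have L2: "d \<in> L2 L"
    using d by (rule has_L2_deriv_imp_L2)
  then show "(\<lambda>x. x * d x) \<in> L2 L"
    by (rule L2_weight)
  show "((\<lambda>s. L2_norm L (\<lambda>x. (x * u s x - x * u t x) / (s - t) - x * d x)) \<longlongrightarrow> 0) (at t within {0..})"
  proof (rule Lim_null_comparison)
    have "((\<lambda>s. \<bar>L\<bar> * L2_norm L (\<lambda>x. (u s x - u t x) / (s - t) - d x)) \<longlongrightarrow> \<bar>L\<bar> * 0) (at t within {0..})"
      using d by (intro tendsto_mult tendsto_const) (simp add: has_curve_deriv_def)
    then show "((\<lambda>s. \<bar>L\<bar> * L2_norm L (\<lambda>x. (u s x - u t x) / (s - t) - d x)) \<longlongrightarrow> 0) (at t within {0..})"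
      by simp
    show "\<forall>\<^sub>F s in at t within {0..}. norm (L2_norm L (\<lambda>x. (x * u s x - x * u t x) / (s - t) - x * d x))
        \<le> \<bar>L\<bar> * L2_norm L (\<lambda>x. (u s x - u t x) / (s - t) - d x)"
      using eventually_nonneg_at_within[of t]
    proof eventually_elim
      case (elim s)
      then have "(\<lambda>x. (u s x - u t x) / (s - t) - d x) \<in> L2 L"
        using u[of s] u[of t] t L2 by (intro L2_divide L2_diff) auto
      from L2_weight(2)[OF this] show ?case
        by (simp add: right_diff_distrib)
    qed
  qed
qed

section \<open>Strong solutions\<close>

lemma L2_norm_le_H1_norm:
  "L2_norm L z \<le> H1_norm L z" "L2_norm L (wderiv L z) \<le> H1_norm L z"
  by (simp_all add: H1_norm_def real_sqrt_sum_squares_ge1 real_sqrt_sum_squares_ge2)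

lemma has_L2_deriv_if_H1_deriv:
  assumes "has_curve_deriv (H1_star L) (H1_norm L) u t d"
  shows "has_L2_deriv L u t d"
  unfolding has_curve_deriv_def
proof
  show "d \<in> L2 L"
    using assms by (auto simp: has_curve_deriv_def H1_star_def H1_L2)
  show "((\<lambda>s. L2_norm L (\<lambda>x. (u s x - u t x) / (s - t) - d x)) \<longlongrightarrow> 0) (at t within {0..})"
    by (rule Lim_null_comparison[where g = "\<lambda>s. H1_norm L (\<lambda>x. (u s x - u t x) / (s - t) - d x)"])
      (use assms in \<open>auto simp: has_curve_deriv_def L2_norm_le_H1_norm\<close>)
qed

text \<open>The exchange of mixed derivatives, (u_x)_t = (u_t)_x: the weak derivative is a bounded
  linear map from \<open>H1\<close> to \<open>L2\<close> and so passes through the limit of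
  quotients. Differentiability in the norm of \<open>H1\<close> is essential here.\<close>

lemma has_L2_deriv_wderiv:
  assumes "0 < L" and u: "\<And>s. 0 \<le> s \<Longrightarrow> u s \<in> H1 L" and t: "0 \<le> t"
    and d: "has_curve_deriv (H1_star L) (H1_norm L) u t d"
  shows "has_L2_deriv L (\<lambda>s. wderiv L (u s)) t (wderiv L d)"
  unfolding has_curve_deriv_def
proof
  have H1d: "d \<in> H1 L"
    using d by (auto simp: has_curve_deriv_def H1_star_def)
  then show "wderiv L d \<in> L2 L"
    by (rule H1_wderiv)
  let ?Q = "\<lambda>s x. (u s x - u t x) / (s - t) - d x"
  show "((\<lambda>s. L2_norm L (\<lambda>x. (wderiv L (u s) x - wderiv L (u t) x) / (s - t) - wderiv L d x)) \<longlongrightarrow> 0)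
      (at t within {0..})"
  proof (rule Lim_null_comparison)
    show "((\<lambda>s. H1_norm L (?Q s)) \<longlongrightarrow> 0) (at t within {0..})"
      using d by (auto simp: has_curve_deriv_def)
    show "\<forall>\<^sub>F s in at t within {0..}.
        norm (L2_norm L (\<lambda>x. (wderiv L (u s) x - wderiv L (u t) x) / (s - t) - wderiv L d x)) \<le> H1_norm L (?Q s)"
      using eventually_nonneg_at_within[of t]
    proof eventually_elim
      case (elim s)
      let ?D = "\<lambda>x. u s x - u t x"
      have H1: "u s \<in> H1 L" "u t \<in> H1 L" "?D \<in> H1 L" "(\<lambda>x. 1 / (s - t) * ?D x) \<in> H1 L"
        using u[of s] u[of t] elim t by (auto intro!: H1_diff(1) H1_scale simp del: times_divide_eq_left)
      have "AE x in lebesgue_on {0<..<L}. (wderiv L (u s) x - wderiv L (u t) x) / (s - t) - wderiv L d x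
          = wderiv L (\<lambda>x. 1 / (s - t) * ?D x - d x) x"
        using wderiv_diff[OF assms(1) H1(1,2)] wderiv_scale[OF assms(1) H1(3), of "1 / (s - t)"]
          wderiv_diff[OF assms(1) H1(4) H1d]
        by eventually_elim simp
      then have "L2_norm L (\<lambda>x. (wderiv L (u s) x - wderiv L (u t) x) / (s - t) - wderiv L d x)
          = L2_norm L (wderiv L (\<lambda>x. 1 / (s - t) * ?D x - d x))"
        by (rule L2_norm_cong_AE[rotated 2])
          (intro L2_diff L2_divide H1_wderiv(1) H1(1,2) H1d H1_diff(1) H1(4))+
      also have "\<dots> \<le> H1_norm L (\<lambda>x. 1 / (s - t) * ?D x - d x)"
        by (rule L2_norm_le_H1_norm)
      finally show ?case by simp
    qed
  qed
qed

text \<open>The C^1 clause in \<open>H1_star\<close>, the C^2 clause in \<open>L2\<close> and the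
  choice inside \<open>tderiv\<close> each bring their own time derivative; uniqueness of limits in
  \<open>L2\<close> identifies them almost everywhere. The function V is the \<open>H1\<close>
  representative of u_t, which gives meaning to u_t at x = L and to the mixed derivative.\<close>

lemma strong_regularityD:
  assumes "0 < L" and u: "strong_regularity L u" and t: "0 \<le> t"
  shows "u t \<in> H1 L" "wderiv L (u t) \<in> H1 L" "tderiv L u t \<in> L2 L"
    and "has_L2_deriv L (tderiv L u) t (tderiv L (tderiv L u) t)"
    and "\<exists>V\<in>H1_star L. (AE x in lebesgue_on {0<..<L}. tderiv L u t x = V x) \<and>
      has_L2_deriv L (\<lambda>s. wderiv L (u s)) t (wderiv L V)"
proof -
  have H2: "u s \<in> H2 L" if "0 \<le> s" for s
    using u that by (auto simp: strong_regularity_def continuous_curve_def)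
  then have H1: "u s \<in> H1 L" if "0 \<le> s" for s
    using that by (auto simp: H2_def)
  show "u t \<in> H1 L" "wderiv L (u t) \<in> H1 L"
    using H2[OF t] by (auto simp: H2_def)
  obtain U where U: "\<And>s. 0 \<le> s \<Longrightarrow> has_curve_deriv (H1_star L) (H1_norm L) u s (U s)"
    using u by (auto simp: strong_regularity_def)
  obtain u' u'' where u': "\<And>s. 0 \<le> s \<Longrightarrow> has_L2_deriv L u s (u' s)"
    and u'': "\<And>s. 0 \<le> s \<Longrightarrow> has_L2_deriv L u' s (u'' s)"
    using u by (auto simp: strong_regularity_def numeral_2_eq_2)
  note tderiv = tderiv_has_L2_deriv[OF u']
  then show "tderiv L u t \<in> L2 L"
    using t has_L2_deriv_imp_L2 by blast
  have eq: "AE x in lebesgue_on {0<..<L}. u' s x = tderiv L u s x" if "0 \<le> s" for s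
    by (rule has_L2_deriv_unique[OF H1_L2[OF H1] that u' tderiv]) (use that in auto)
  have "has_L2_deriv L (tderiv L u) t (u'' t)"
    by (rule has_L2_deriv_cong_AE[OF _ _ eq _ _ t u''[OF t]])
      (use u' tderiv u''[OF t] has_L2_deriv_imp_L2 in blast)+
  then show "has_L2_deriv L (tderiv L u) t (tderiv L (tderiv L u) t)"
    by (rule tderiv_has_L2_deriv)
  show "\<exists>V\<in>H1_star L. (AE x in lebesgue_on {0<..<L}. tderiv L u t x = V x) \<and>
      has_L2_deriv L (\<lambda>s. wderiv L (u s)) t (wderiv L V)"
  proof (intro bexI conjI)
    show "AE x in lebesgue_on {0<..<L}. tderiv L u t x = U t x"
      by (rule has_L2_deriv_unique[OF H1_L2[OF H1] t tderiv[OF t] has_L2_deriv_if_H1_deriv[OF U[OF t]]])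
    show "has_L2_deriv L (\<lambda>s. wderiv L (u s)) t (wderiv L (U t))"
      by (rule has_L2_deriv_wderiv[OF assms(1) H1 t U[OF t]])
    show "U t \<in> H1_star L"
      using U[OF t] by (simp add: has_curve_deriv_def)
  qed
qed

section \<open>Pointwise inequalities behind the boundary terms and the multiplier\<close>

text \<open>In terms of y = \<gamma> c - d the boundary conditions are triangular: the second gives
  y from b, and then the first gives c from a and b. The value of c mixes a and b, so its square has
  a cross term, which Young's inequality removes at the cost of the factors 1 + \<epsilon> and 1 +
  1/\<epsilon>. The two hypotheses on \<delta> compare the resulting coefficients of a^2 and b^2
  with the dissipation.\<close>

lemma boundary_dissipation:
  fixes L \<rho> \<mu> \<beta> \<alpha>\<^sub>1 \<gamma> \<alpha> \<xi>\<^sub>1 \<xi>\<^sub>2 \<epsilon> \<delta> a b c d :: real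
  assumes pos: "0 < L" "0 < \<beta>" "0 < \<alpha>\<^sub>1" "0 < \<epsilon>" "0 < \<delta>"
    and \<alpha>: "\<alpha> = \<alpha>\<^sub>1 + \<gamma>\<^sup>2 * \<beta>"
    and \<delta>1: "\<delta> * L * (\<rho> + (1 + \<epsilon>) * \<xi>\<^sub>1\<^sup>2 / \<alpha>\<^sub>1) \<le> 2 * \<xi>\<^sub>1"
    and \<delta>2: "\<delta> * L * (\<mu> + (1 + 1 / \<epsilon>) * \<gamma>\<^sup>2 * \<xi>\<^sub>2\<^sup>2 / \<alpha>\<^sub>1 + \<xi>\<^sub>2\<^sup>2 / \<beta>) \<le> 2 * \<xi>\<^sub>2"
    and bc1: "\<alpha> * c - \<gamma> * \<beta> * d = - \<xi>\<^sub>1 * a"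
    and bc2: "\<beta> * d - \<gamma> * \<beta> * c = - \<xi>\<^sub>2 * b"
  shows "a * (\<alpha> * c - \<gamma> * \<beta> * d) + b * (\<beta> * d - \<gamma> * \<beta> * c) +
    \<delta> * (L * ((\<rho> * a\<^sup>2 + \<mu> * b\<^sup>2 + \<alpha> * c\<^sup>2 - 2 * \<gamma> * \<beta> * c * d + \<beta> * d\<^sup>2) / 2)) \<le> 0"
proof -
  define y where "y = \<gamma> * c - d"
  have y: "y = \<xi>\<^sub>2 * b / \<beta>"
    using bc2 pos by (simp add: y_def field_simps)
  have c: "\<alpha>\<^sub>1 * c = - (\<xi>\<^sub>1 * a + \<gamma> * \<xi>\<^sub>2 * b)"
  proof -
    have "\<alpha>\<^sub>1 * c + \<gamma> * (\<beta> * y) = - \<xi>\<^sub>1 * a"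
      using bc1 by (simp add: \<alpha> y_def power2_eq_square algebra_simps)
    then show ?thesis
      using pos by (simp add: y)
  qed
  \<comment> \<open>Division by \<epsilon> gives the cross term the coefficient -2, and the two
    squares the weights \<epsilon> and 1/\<epsilon>.\<close>
  have "0 \<le> (\<epsilon> * (\<xi>\<^sub>1 * a) - \<gamma> * \<xi>\<^sub>2 * b)\<^sup>2 / \<epsilon>"
    using pos by simp
  then have young: "(\<xi>\<^sub>1 * a + \<gamma> * \<xi>\<^sub>2 * b)\<^sup>2
      \<le> (1 + \<epsilon>) * \<xi>\<^sub>1\<^sup>2 * a\<^sup>2 + (1 + 1 / \<epsilon>) * \<gamma>\<^sup>2 * \<xi>\<^sub>2\<^sup>2 * b\<^sup>2"
    using pos by (simp add: field_simps power2_eq_square)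
  have "\<alpha> * c\<^sup>2 - 2 * \<gamma> * \<beta> * c * d + \<beta> * d\<^sup>2 = \<alpha>\<^sub>1 * c\<^sup>2 + \<beta> * y\<^sup>2"
    by (simp add: \<alpha> y_def power2_eq_square algebra_simps)
  also have "\<beta> * y\<^sup>2 = \<xi>\<^sub>2\<^sup>2 / \<beta> * b\<^sup>2"
    using pos by (simp add: y power2_eq_square)
  also have "\<alpha>\<^sub>1 * c\<^sup>2 = (\<alpha>\<^sub>1 * c)\<^sup>2 / \<alpha>\<^sub>1"
    using pos by (simp add: power2_eq_square)
  also have "\<dots> = (\<xi>\<^sub>1 * a + \<gamma> * \<xi>\<^sub>2 * b)\<^sup>2 / \<alpha>\<^sub>1"
    unfolding c power2_minus ..
  also have "\<dots> \<le> ((1 + \<epsilon>) * \<xi>\<^sub>1\<^sup>2 * a\<^sup>2 + (1 + 1 / \<epsilon>) * \<gamma>\<^sup>2 * \<xi>\<^sub>2\<^sup>2 * b\<^sup>2) / \<alpha>\<^sub>1"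
    using young pos by (intro divide_right_mono) auto
  finally have le: "\<rho> * a\<^sup>2 + \<mu> * b\<^sup>2 + \<alpha> * c\<^sup>2 - 2 * \<gamma> * \<beta> * c * d + \<beta> * d\<^sup>2 \<le>
      (\<rho> + (1 + \<epsilon>) * \<xi>\<^sub>1\<^sup>2 / \<alpha>\<^sub>1) * a\<^sup>2
      + (\<mu> + (1 + 1 / \<epsilon>) * \<gamma>\<^sup>2 * \<xi>\<^sub>2\<^sup>2 / \<alpha>\<^sub>1 + \<xi>\<^sub>2\<^sup>2 / \<beta>) * b\<^sup>2"
    by (simp add: add_divide_distrib algebra_simps)
  have distrib: "r * (X * p + Y * q) = (r * X) * p + (r * Y) * q" for r X Y p q :: real
    by (simp add: algebra_simps)
  from le have "\<delta> * L * (\<rho> * a\<^sup>2 + \<mu> * b\<^sup>2 + \<alpha> * c\<^sup>2 - 2 * \<gamma> * \<beta> * c * d + \<beta> * d\<^sup>2) \<le>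
      \<delta> * L * ((\<rho> + (1 + \<epsilon>) * \<xi>\<^sub>1\<^sup>2 / \<alpha>\<^sub>1) * a\<^sup>2
      + (\<mu> + (1 + 1 / \<epsilon>) * \<gamma>\<^sup>2 * \<xi>\<^sub>2\<^sup>2 / \<alpha>\<^sub>1 + \<xi>\<^sub>2\<^sup>2 / \<beta>) * b\<^sup>2)"
    using pos by (intro mult_left_mono) auto
  also have "\<dots> = (\<delta> * L * (\<rho> + (1 + \<epsilon>) * \<xi>\<^sub>1\<^sup>2 / \<alpha>\<^sub>1)) * a\<^sup>2
      + (\<delta> * L * (\<mu> + (1 + 1 / \<epsilon>) * \<gamma>\<^sup>2 * \<xi>\<^sub>2\<^sup>2 / \<alpha>\<^sub>1 + \<xi>\<^sub>2\<^sup>2 / \<beta>)) * b\<^sup>2"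
    by (rule distrib)
  also have "\<dots> \<le> 2 * \<xi>\<^sub>1 * a\<^sup>2 + 2 * \<xi>\<^sub>2 * b\<^sup>2"
    using \<delta>1 \<delta>2 by (intro add_mono mult_right_mono) auto
  finally show ?thesis
    unfolding bc1 bc2 by (simp add: power2_eq_square algebra_simps)
qed

text \<open>Origin of \<eta>: with d = \<gamma> c - y there are three products, a c, b c and b y.
  Young's inequality, balanced between the kinetic and the elastic coefficient, bounds them with the
  factors \<open>?s1\<close>, \<open>?s2\<close> and \<open>?s3\<close>. The four squares then
  receive the coefficients s1, s3 + s2, s1 + s2 and s3, all at most \<eta>.\<close>

lemma multiplier_bound:
  fixes \<rho> \<mu> \<beta> \<alpha>\<^sub>1 \<gamma> \<alpha> \<eta> L a b c d x :: real
  assumes pos: "0 < \<rho>" "0 < \<mu>" "0 < \<beta>" "0 < \<alpha>\<^sub>1" and x: "0 < x" "x < L"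
    and \<alpha>: "\<alpha> = \<alpha>\<^sub>1 + \<gamma>\<^sup>2 * \<beta>"
    and \<eta>: "sqrt (\<rho> / \<alpha>\<^sub>1) + sqrt (\<mu> * \<gamma>\<^sup>2 / \<alpha>\<^sub>1) \<le> \<eta>" "sqrt (\<mu> / \<beta>) + sqrt (\<mu> * \<gamma>\<^sup>2 / \<alpha>\<^sub>1) \<le> \<eta>"
  shows "\<bar>x * (\<rho> * (a * c) + \<mu> * (b * d))\<bar>
    \<le> L * \<eta> * ((\<rho> * a\<^sup>2 + \<mu> * b\<^sup>2 + \<alpha> * c\<^sup>2 - 2 * \<gamma> * \<beta> * c * d + \<beta> * d\<^sup>2) / 2)"
proof -
  have young: "2 * (m * \<bar>p * q\<bar>) \<le> sqrt (m / n) * (m * p\<^sup>2 + n * q\<^sup>2)" if "0 < m" "0 < n" for m n p q :: real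
  proof -
    have "0 \<le> (sqrt m * \<bar>p\<bar> - sqrt n * \<bar>q\<bar>)\<^sup>2"
      by simp
    also have "\<dots> = m * p\<^sup>2 + n * q\<^sup>2 - 2 * (sqrt m * sqrt n * \<bar>p * q\<bar>)"
      using that by (simp add: power2_diff power_mult_distrib abs_mult)
    finally have "sqrt (m / n) * (2 * (sqrt m * sqrt n * \<bar>p * q\<bar>)) \<le> sqrt (m / n) * (m * p\<^sup>2 + n * q\<^sup>2)"
      using that by (intro mult_left_mono) auto
    moreover have "sqrt (m / n) * (2 * (sqrt m * sqrt n * \<bar>p * q\<bar>)) = 2 * ((sqrt m * sqrt m) * \<bar>p * q\<bar>)"
      using that by (simp add: real_sqrt_divide)
    ultimately show ?thesis
      using that by simp
  qed
  define y where "y = \<gamma> * c - d"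
  define e where "e = \<rho> * a\<^sup>2 + \<mu> * b\<^sup>2 + \<alpha>\<^sub>1 * c\<^sup>2 + \<beta> * y\<^sup>2"
  have e: "\<rho> * a\<^sup>2 + \<mu> * b\<^sup>2 + \<alpha> * c\<^sup>2 - 2 * \<gamma> * \<beta> * c * d + \<beta> * d\<^sup>2 = e"
    by (simp add: e_def \<alpha> y_def power2_eq_square algebra_simps)
  let ?s1 = "sqrt (\<rho> / \<alpha>\<^sub>1)" and ?s2 = "sqrt (\<mu> * \<gamma>\<^sup>2 / \<alpha>\<^sub>1)" and ?s3 = "sqrt (\<mu> / \<beta>)"
  have s2: "?s2 = \<bar>\<gamma>\<bar> * sqrt (\<mu> / \<alpha>\<^sub>1)"
    by (simp add: real_sqrt_mult real_sqrt_divide)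
  have nonneg: "0 \<le> ?s1" "0 \<le> ?s2" "0 \<le> ?s3"
    using pos by auto
  have "2 * (\<mu> * \<bar>b * (\<gamma> * c)\<bar>) = \<bar>\<gamma>\<bar> * (2 * (\<mu> * \<bar>b * c\<bar>))"
    by (simp add: abs_mult)
  also have "\<dots> \<le> \<bar>\<gamma>\<bar> * (sqrt (\<mu> / \<alpha>\<^sub>1) * (\<mu> * b\<^sup>2 + \<alpha>\<^sub>1 * c\<^sup>2))"
    using young[of \<mu> \<alpha>\<^sub>1 b c] pos by (intro mult_left_mono) auto
  finally have y2: "2 * (\<mu> * \<bar>b * (\<gamma> * c)\<bar>) \<le> ?s2 * (\<mu> * b\<^sup>2 + \<alpha>\<^sub>1 * c\<^sup>2)"
    by (simp add: s2)
  have "\<rho> * (a * c) + \<mu> * (b * d) = \<rho> * (a * c) + \<mu> * (b * (\<gamma> * c)) - \<mu> * (b * y)"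
    by (simp add: y_def algebra_simps)
  then have "\<bar>\<rho> * (a * c) + \<mu> * (b * d)\<bar> \<le> \<bar>\<rho> * (a * c)\<bar> + \<bar>\<mu> * (b * (\<gamma> * c))\<bar> + \<bar>\<mu> * (b * y)\<bar>"
    by linarith
  also have "\<dots> = \<rho> * \<bar>a * c\<bar> + \<mu> * \<bar>b * (\<gamma> * c)\<bar> + \<mu> * \<bar>b * y\<bar>"
    using pos by (simp add: abs_mult)
  finally have split: "\<bar>\<rho> * (a * c) + \<mu> * (b * d)\<bar>
      \<le> \<rho> * \<bar>a * c\<bar> + \<mu> * \<bar>b * (\<gamma> * c)\<bar> + \<mu> * \<bar>b * y\<bar>" .
  have combine: "2 * z \<le> p + q + r" if "z \<le> u + v + w" "2 * u \<le> p" "2 * v \<le> q" "2 * w \<le> r"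
    for z u v w p q r :: real
    using that by linarith
  have "2 * \<bar>\<rho> * (a * c) + \<mu> * (b * d)\<bar>
      \<le> ?s1 * (\<rho> * a\<^sup>2 + \<alpha>\<^sub>1 * c\<^sup>2) + ?s2 * (\<mu> * b\<^sup>2 + \<alpha>\<^sub>1 * c\<^sup>2) + ?s3 * (\<mu> * b\<^sup>2 + \<beta> * y\<^sup>2)"
    by (rule combine[OF split young[OF pos(1,4)] y2 young[OF pos(2,3)]])
  also have "\<dots> = ?s1 * (\<rho> * a\<^sup>2) + (?s3 + ?s2) * (\<mu> * b\<^sup>2) + (?s1 + ?s2) * (\<alpha>\<^sub>1 * c\<^sup>2) + ?s3 * (\<beta> * y\<^sup>2)"
    by (simp add: algebra_simps)
  also have "\<dots> \<le> \<eta> * (\<rho> * a\<^sup>2) + \<eta> * (\<mu> * b\<^sup>2) + \<eta> * (\<alpha>\<^sub>1 * c\<^sup>2) + \<eta> * (\<beta> * y\<^sup>2)"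
  proof -
    have "?s1 \<le> \<eta>" "?s3 \<le> \<eta>"
      using nonneg \<eta> by linarith+
    then show ?thesis
      using \<eta> pos by (intro add_mono mult_right_mono) auto
  qed
  finally have *: "\<bar>\<rho> * (a * c) + \<mu> * (b * d)\<bar> \<le> \<eta> * (e / 2)"
    by (simp add: e_def algebra_simps)
  have "\<bar>x * (\<rho> * (a * c) + \<mu> * (b * d))\<bar> = x * \<bar>\<rho> * (a * c) + \<mu> * (b * d)\<bar>"
    using x by (simp add: abs_mult)
  also have "\<dots> \<le> L * (\<eta> * (e / 2))"
    using x * by (intro mult_mono) auto
  finally show ?thesis
    unfolding e by (simp only: mult.assoc)
qed

section \<open>Energy and dissipation densities\<close>

text \<open>Expanded with \<alpha> rather than as a sum of squares, to match the coefficients of the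
  equations. As a function of four numbers it also serves for the boundary value at x = L.\<close>

definition energy_density :: "real \<Rightarrow> real \<Rightarrow> real \<Rightarrow> real \<Rightarrow> real \<Rightarrow> real \<Rightarrow> real \<Rightarrow> real \<Rightarrow> real \<Rightarrow> real" where
  "energy_density \<rho> \<mu> \<alpha> \<beta> \<gamma> a b c d =
     (\<rho> * a\<^sup>2 + \<mu> * b\<^sup>2 + \<alpha> * c\<^sup>2 - 2 * \<gamma> * \<beta> * c * d + \<beta> * d\<^sup>2) / 2"

lemma energy_eq_integral_density:
  assumes "\<alpha> = \<alpha>\<^sub>1 + \<gamma>\<^sup>2 * \<beta>"
  shows "energy L \<rho> \<mu> \<alpha>\<^sub>1 \<beta> \<gamma> v p t = (\<integral>x. energy_density \<rho> \<mu> \<alpha> \<beta> \<gamma> (tderiv L v t x) (tderiv L p t x)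
     (wderiv L (v t) x) (wderiv L (p t) x) \<partial>lebesgue_on {0<..<L})"
proof -
  have "energy_density \<rho> \<mu> \<alpha> \<beta> \<gamma> a b c d
      = 1 / 2 * (\<rho> * \<bar>a\<bar>\<^sup>2 + \<mu> * \<bar>b\<bar>\<^sup>2 + \<alpha>\<^sub>1 * \<bar>c\<bar>\<^sup>2 + \<beta> * \<bar>\<gamma> * c - d\<bar>\<^sup>2)" for a b c d
    by (simp add: energy_density_def assms power2_eq_square field_simps)
  then show ?thesis
    by (simp only: energy_def integral_mult_right_zero)
qed

text \<open>Reduction to inner products in \<open>L2\<close>, for which the product rule in time and
  the passage to the limit are known.\<close>

lemma integral_energy_density:
  assumes L2: "a \<in> L2 L" "b \<in> L2 L" "c \<in> L2 L" "d \<in> L2 L"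
  defines "I \<equiv> \<lambda>f g. \<integral>x. f x * g x \<partial>lebesgue_on {0<..<L}"
  shows "(\<integral>x. energy_density \<rho> \<mu> \<alpha> \<beta> \<gamma> (a x) (b x) (c x) (d x) \<partial>lebesgue_on {0<..<L})
     = (\<rho> * I a a + \<mu> * I b b + \<alpha> * I c c - 2 * \<gamma> * \<beta> * I c d + \<beta> * I d d) / 2"
    and "integrable (lebesgue_on {0<..<L}) (\<lambda>x. energy_density \<rho> \<mu> \<alpha> \<beta> \<gamma> (a x) (b x) (c x) (d x))"
proof -
  note int [simp] = L2_integrable_mult[OF L2(1,1)] L2_integrable_mult[OF L2(2,2)] L2_integrable_mult[OF L2(3,3)]
    L2_integrable_mult[OF L2(3,4)] L2_integrable_mult[OF L2(4,4)]
  have *: "energy_density \<rho> \<mu> \<alpha> \<beta> \<gamma> (a x) (b x) (c x) (d x) = (\<rho> * (a x * a x) + \<mu> * (b x * b x)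
      + \<alpha> * (c x * c x) - 2 * \<gamma> * \<beta> * (c x * d x) + \<beta> * (d x * d x)) / 2" for x
    by (simp add: energy_density_def power2_eq_square)
  show "(\<integral>x. energy_density \<rho> \<mu> \<alpha> \<beta> \<gamma> (a x) (b x) (c x) (d x) \<partial>lebesgue_on {0<..<L})
     = (\<rho> * I a a + \<mu> * I b b + \<alpha> * I c c - 2 * \<gamma> * \<beta> * I c d + \<beta> * I d d) / 2"
    unfolding * I_def by simp
  show "integrable (lebesgue_on {0<..<L}) (\<lambda>x. energy_density \<rho> \<mu> \<alpha> \<beta> \<gamma> (a x) (b x) (c x) (d x))"
    unfolding * by simp
qed

text \<open>
  The integrand of the time derivative of the Lyapunov functional, at a time with
  \<open>v\<^sub>t = a\<close>, \<open>p\<^sub>t = b\<close>, \<open>v\<^sub>x = c\<close>, \<open>p\<^sub>x = d\<close>, where \<open>F = \<rho> v\<^sub>t\<^sub>t\<close>, \<open>G = \<mu> p\<^sub>t\<^sub>t\<close> and the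
  primed variables are space derivatives.
\<close>

definition dissipation_density ::
    "real \<Rightarrow> real \<Rightarrow> real \<Rightarrow> real \<Rightarrow> real \<Rightarrow> real \<Rightarrow> real \<Rightarrow>
     real \<Rightarrow> real \<Rightarrow> real \<Rightarrow> real \<Rightarrow> real \<Rightarrow> real \<Rightarrow> real \<Rightarrow> real \<Rightarrow> real" where
  "dissipation_density \<alpha> \<beta> \<gamma> \<rho> \<mu> \<delta> x a a' b b' c F d G =
     a * F + b * G + \<alpha> * (c * a') - \<gamma> * \<beta> * (a' * d + c * b') + \<beta> * (d * b')
     + \<delta> * (x * (F * c + \<rho> * (a * a') + G * d + \<mu> * (b * b')))"

text \<open>Adding \<delta> e to the integrand makes it an exact derivative in x: that of the energy
  flux plus \<delta> x e. Both vanish at 0, the flux because a and b do and the other term because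
  of its factor x, so only the boundary expression at L survives.\<close>

lemma integral_dissipation_density:
  assumes "0 < L"
    and P: "primitive_on L a a'" "primitive_on L b b'" "primitive_on L c c'" "primitive_on L d d'"
    and zero: "a 0 = 0" "b 0 = 0"
    and bdry: "a L * (\<alpha> * c L - \<gamma> * \<beta> * d L) + b L * (\<beta> * d L - \<gamma> * \<beta> * c L)
      + \<delta> * (L * energy_density \<rho> \<mu> \<alpha> \<beta> \<gamma> (a L) (b L) (c L) (d L)) \<le> 0"
  defines "J \<equiv> \<lambda>x. dissipation_density \<alpha> \<beta> \<gamma> \<rho> \<mu> \<delta> x (a x) (a' x) (b x) (b' x)
      (c x) (\<alpha> * c' x - \<gamma> * \<beta> * d' x) (d x) (\<beta> * d' x - \<gamma> * \<beta> * c' x)"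
    and "e \<equiv> \<lambda>x. energy_density \<rho> \<mu> \<alpha> \<beta> \<gamma> (a x) (b x) (c x) (d x)"
  shows "integrable (lebesgue_on {0<..<L}) J"
    and "(\<integral>x. J x \<partial>lebesgue_on {0<..<L}) \<le> - \<delta> * (\<integral>x. e x \<partial>lebesgue_on {0<..<L})"
proof -
  let ?M = "lebesgue_on {0<..<L}"
  define e' where "e' x = \<rho> * (a x * a' x) + \<mu> * (b x * b' x) + \<alpha> * (c x * c' x)
      - \<gamma> * \<beta> * (c x * d' x + d x * c' x) + \<beta> * (d x * d' x)" for x
  have e: "primitive_on L e e'"
  proof -
    note * = primitive_on_scale[of L _ _ "1 / 2",
      OF primitive_on_add[OF primitive_on_diff[OF primitive_on_add[OF primitive_on_add[OF
        primitive_on_scale[OF primitive_on_mult[OF P(1,1)], of \<rho>]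
        primitive_on_scale[OF primitive_on_mult[OF P(2,2)], of \<mu>]]
        primitive_on_scale[OF primitive_on_mult[OF P(3,3)], of \<alpha>]]
        primitive_on_scale[OF primitive_on_mult[OF P(3,4)], of "2 * \<gamma> * \<beta>"]]
        primitive_on_scale[OF primitive_on_mult[OF P(4,4)], of \<beta>]]]
    show ?thesis
      by (rule primitive_on_cong[OF *])
        (simp_all add: e_def e'_def energy_density_def power2_eq_square algebra_simps)
  qed
  define P where "P x = a x * (\<alpha> * c x - \<gamma> * \<beta> * d x) + b x * (\<beta> * d x - \<gamma> * \<beta> * c x) + \<delta> * (x * e x)" for x
  have Pprim: "primitive_on L P (\<lambda>x. J x + \<delta> * e x)"
  proof -
    note * = primitive_on_add[OF primitive_on_add[OF
      primitive_on_mult[OF P(1) primitive_on_diff[OF primitive_on_scale[OF P(3), of \<alpha>] primitive_on_scale[OF P(4), of "\<gamma> * \<beta>"]]]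
      primitive_on_mult[OF P(2) primitive_on_diff[OF primitive_on_scale[OF P(4), of \<beta>] primitive_on_scale[OF P(3), of "\<gamma> * \<beta>"]]]]
      primitive_on_scale[OF primitive_on_mult[OF primitive_on_id e], of \<delta>]]
    show ?thesis
      by (rule primitive_on_cong[OF *])
        (simp_all add: P_def J_def e'_def dissipation_density_def algebra_simps)
  qed
  have int_e: "integrable ?M e"
    by (rule integrable_continuous_Ioo[OF primitive_on_continuous[OF e]])
  have "integrable ?M (\<lambda>x. (J x + \<delta> * e x) - \<delta> * e x)"
    by (intro Bochner_Integration.integrable_diff primitive_on_integrable[OF Pprim]
        Bochner_Integration.integrable_mult_right int_e)
  then show int_J: "integrable ?M J"
    by simp
  have "(\<integral>x. J x \<partial>?M) + \<delta> * (\<integral>x. e x \<partial>?M) = (\<integral>x. J x + \<delta> * e x \<partial>?M)"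
    using int_J int_e by simp
  also have "\<dots> = P L - P 0"
    using primitive_on_integral[OF Pprim] \<open>0 < L\<close> by simp
  also have "\<dots> \<le> 0"
    using bdry by (simp add: P_def e_def zero)
  finally show "(\<integral>x. J x \<partial>?M) \<le> - \<delta> * (\<integral>x. e x \<partial>?M)"
    by simp
qed

section \<open>The Lyapunov functional\<close>

text \<open>The functional is a linear combination of inner products in \<open>L2\<close>. No
  equation is used yet: the time derivatives of \<open>c\<close> and \<open>d\<close> stand where
  \<open>dissipation_density\<close> has the space derivatives of \<open>a\<close> and
  \<open>b\<close>.\<close>

lemma lyapunov_has_derivative:
  fixes \<alpha> \<beta> \<gamma> \<rho> \<mu> \<delta> :: real
  assumes L2: "\<And>s. 0 \<le> s \<Longrightarrow> a s \<in> L2 L" "\<And>s. 0 \<le> s \<Longrightarrow> b s \<in> L2 L"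
      "\<And>s. 0 \<le> s \<Longrightarrow> c s \<in> L2 L" "\<And>s. 0 \<le> s \<Longrightarrow> d s \<in> L2 L"
    and t: "0 \<le> t"
    and D: "has_L2_deriv L a t a\<^sub>t" "has_L2_deriv L b t b\<^sub>t" "has_L2_deriv L c t c\<^sub>t" "has_L2_deriv L d t d\<^sub>t"
  defines "J \<equiv> \<lambda>x. dissipation_density \<alpha> \<beta> \<gamma> \<rho> \<mu> \<delta> x (a t x) (c\<^sub>t x) (b t x) (d\<^sub>t x)
      (c t x) (\<rho> * a\<^sub>t x) (d t x) (\<mu> * b\<^sub>t x)"
  shows "((\<lambda>s. (\<integral>x. energy_density \<rho> \<mu> \<alpha> \<beta> \<gamma> (a s x) (b s x) (c s x) (d s x) \<partial>lebesgue_on {0<..<L})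
      + \<delta> * (\<integral>x. x * (\<rho> * (a s x * c s x) + \<mu> * (b s x * d s x)) \<partial>lebesgue_on {0<..<L}))
      has_real_derivative (\<integral>x. J x \<partial>lebesgue_on {0<..<L})) (at t within {0..})"
    and "integrable (lebesgue_on {0<..<L}) J"
proof -
  let ?M = "lebesgue_on {0<..<L}"
  define I where "I f g = (\<integral>x. f x * g x \<partial>?M)" for f g :: "real \<Rightarrow> real"
  define V where "V s = (\<rho> * I (a s) (a s) + \<mu> * I (b s) (b s) + \<alpha> * I (c s) (c s)
      - 2 * \<gamma> * \<beta> * I (c s) (d s) + \<beta> * I (d s) (d s)) / 2
      + \<delta> * (\<rho> * I (\<lambda>x. x * a s x) (c s) + \<mu> * I (\<lambda>x. x * b s x) (d s))" for s
  have V: "V s = (\<integral>x. energy_density \<rho> \<mu> \<alpha> \<beta> \<gamma> (a s x) (b s x) (c s x) (d s x) \<partial>?M)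
      + \<delta> * (\<integral>x. x * (\<rho> * (a s x * c s x) + \<mu> * (b s x * d s x)) \<partial>?M)" if s: "0 \<le> s" for s
  proof -
    have "(\<integral>x. x * (\<rho> * (a s x * c s x) + \<mu> * (b s x * d s x)) \<partial>?M)
        = (\<integral>x. \<rho> * ((x * a s x) * c s x) + \<mu> * ((x * b s x) * d s x) \<partial>?M)"
      by (intro Bochner_Integration.integral_cong refl) (simp add: algebra_simps)
    also have "\<dots> = \<rho> * I (\<lambda>x. x * a s x) (c s) + \<mu> * I (\<lambda>x. x * b s x) (d s)"
      unfolding I_def
      using L2_integrable_mult[OF L2_weight(1)[OF L2(1)] L2(3), OF s s]
        L2_integrable_mult[OF L2_weight(1)[OF L2(2)] L2(4), OF s s] by simp
    finally show ?thesis
      unfolding V_def integral_energy_density(1)[OF L2, OF s s s s] by (simp add: I_def)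
  qed
  note L2t = L2[OF t] D[THEN has_L2_deriv_imp_L2] L2_weight(1)[OF L2(1)[OF t]] L2_weight(1)[OF L2(2)[OF t]]
    L2_weight(1)[OF D(1)[THEN has_L2_deriv_imp_L2]] L2_weight(1)[OF D(2)[THEN has_L2_deriv_imp_L2]]
  define \<Delta> where "\<Delta> f f' g g' = (\<integral>x. f' x * g x + f x * g' x \<partial>?M)" for f f' g g' :: "real \<Rightarrow> real"
  have inner: "((\<lambda>s. I (f s) (g s)) has_real_derivative \<Delta> (f t) f' (g t) g') (at t within {0..})"
    if "\<And>s. 0 \<le> s \<Longrightarrow> f s \<in> L2 L" "\<And>s. 0 \<le> s \<Longrightarrow> g s \<in> L2 L"
      "has_L2_deriv L f t f'" "has_L2_deriv L g t g'" for f g f' g'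
    unfolding I_def \<Delta>_def by (rule has_L2_deriv_inner[OF that(1,2) t that(3,4)])
  have V': "(V has_real_derivative (\<rho> * \<Delta> (a t) a\<^sub>t (a t) a\<^sub>t + \<mu> * \<Delta> (b t) b\<^sub>t (b t) b\<^sub>t + \<alpha> * \<Delta> (c t) c\<^sub>t (c t) c\<^sub>t
      - 2 * \<gamma> * \<beta> * \<Delta> (c t) c\<^sub>t (d t) d\<^sub>t + \<beta> * \<Delta> (d t) d\<^sub>t (d t) d\<^sub>t) / 2
      + \<delta> * (\<rho> * \<Delta> (\<lambda>x. x * a t x) (\<lambda>x. x * a\<^sub>t x) (c t) c\<^sub>t
        + \<mu> * \<Delta> (\<lambda>x. x * b t x) (\<lambda>x. x * b\<^sub>t x) (d t) d\<^sub>t)) (at t within {0..})"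
    unfolding V_def
    by (intro DERIV_add DERIV_diff DERIV_cmult DERIV_cdivide inner L2 D
        L2_weight(1) has_L2_deriv_weight[OF _ t])
  have J: "J x = (\<rho> * (a\<^sub>t x * a t x + a t x * a\<^sub>t x) + \<mu> * (b\<^sub>t x * b t x + b t x * b\<^sub>t x)
      + \<alpha> * (c\<^sub>t x * c t x + c t x * c\<^sub>t x) - 2 * \<gamma> * \<beta> * (c\<^sub>t x * d t x + c t x * d\<^sub>t x)
      + \<beta> * (d\<^sub>t x * d t x + d t x * d\<^sub>t x)) / 2
      + \<delta> * (\<rho> * ((x * a\<^sub>t x) * c t x + (x * a t x) * c\<^sub>t x)
        + \<mu> * ((x * b\<^sub>t x) * d t x + (x * b t x) * d\<^sub>t x))" for x
    by (simp add: J_def dissipation_density_def field_simps)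
  have pair: "has_bochner_integral ?M (\<lambda>x. f' x * g x + f x * g' x) (\<Delta> f f' g g')"
    if "f \<in> L2 L" "f' \<in> L2 L" "g \<in> L2 L" "g' \<in> L2 L" for f f' g g'
    unfolding \<Delta>_def using that by (intro has_bochner_integral_integrable) (simp add: L2_integrable_mult)
  have bochner: "has_bochner_integral ?M J ((\<rho> * \<Delta> (a t) a\<^sub>t (a t) a\<^sub>t + \<mu> * \<Delta> (b t) b\<^sub>t (b t) b\<^sub>t + \<alpha> * \<Delta> (c t) c\<^sub>t (c t) c\<^sub>t
      - 2 * \<gamma> * \<beta> * \<Delta> (c t) c\<^sub>t (d t) d\<^sub>t + \<beta> * \<Delta> (d t) d\<^sub>t (d t) d\<^sub>t) / 2
      + \<delta> * (\<rho> * \<Delta> (\<lambda>x. x * a t x) (\<lambda>x. x * a\<^sub>t x) (c t) c\<^sub>t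
        + \<mu> * \<Delta> (\<lambda>x. x * b t x) (\<lambda>x. x * b\<^sub>t x) (d t) d\<^sub>t))"
    unfolding J[abs_def]
    by (intro has_bochner_integral_add has_bochner_integral_diff has_bochner_integral_mult_right
        has_bochner_integral_divide_zero pair L2t)
  then show "integrable ?M J"
    by (rule integrable.intros)
  have "(\<integral>x. J x \<partial>?M) = (\<rho> * \<Delta> (a t) a\<^sub>t (a t) a\<^sub>t + \<mu> * \<Delta> (b t) b\<^sub>t (b t) b\<^sub>t + \<alpha> * \<Delta> (c t) c\<^sub>t (c t) c\<^sub>t
      - 2 * \<gamma> * \<beta> * \<Delta> (c t) c\<^sub>t (d t) d\<^sub>t + \<beta> * \<Delta> (d t) d\<^sub>t (d t) d\<^sub>t) / 2
      + \<delta> * (\<rho> * \<Delta> (\<lambda>x. x * a t x) (\<lambda>x. x * a\<^sub>t x) (c t) c\<^sub>t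
        + \<mu> * \<Delta> (\<lambda>x. x * b t x) (\<lambda>x. x * b\<^sub>t x) (d t) d\<^sub>t)"
    using bochner by (rule has_bochner_integral_integral_eq)
  with V' have "(V has_real_derivative (\<integral>x. J x \<partial>?M)) (at t within {0..})"
    by simp
  then show "((\<lambda>s. (\<integral>x. energy_density \<rho> \<mu> \<alpha> \<beta> \<gamma> (a s x) (b s x) (c s x) (d s x) \<partial>?M)
      + \<delta> * (\<integral>x. x * (\<rho> * (a s x * c s x) + \<mu> * (b s x * d s x)) \<partial>?M))
      has_real_derivative (\<integral>x. J x \<partial>?M)) (at t within {0..})"
    by (rule has_field_derivative_transform_within[OF _ zero_less_one]) (use t V in auto)
qed

text \<open>Integrating factor exp(\<kappa> s). The differential inequality is available only at
  positive times, so the initial value enters through continuity alone.\<close>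

lemma exponential_decay:
  fixes V :: "real \<Rightarrow> real"
  assumes cont: "continuous_on {0..} V" and t: "0 \<le> t"
    and D: "\<And>s. 0 < s \<Longrightarrow> \<exists>D. (V has_real_derivative D) (at s) \<and> D \<le> - \<kappa> * V s"
  shows "V t \<le> V 0 * exp (- \<kappa> * t)"
proof -
  have "V t * exp (\<kappa> * t) \<le> V 0 * exp (\<kappa> * 0)"
  proof (rule DERIV_nonpos_imp_decreasing_open[OF t])
    show "continuous_on {0..t} (\<lambda>s. V s * exp (\<kappa> * s))"
      by (intro continuous_intros continuous_on_subset[OF cont]) auto
    fix s assume "0 < s" "s < t"
    then obtain D where D: "(V has_real_derivative D) (at s)" "D \<le> - \<kappa> * V s"
      using D by blast
    have "((\<lambda>s. V s * exp (\<kappa> * s)) has_real_derivative (D + \<kappa> * V s) * exp (\<kappa> * s)) (at s)"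
      by (rule derivative_eq_intros D(1) refl)+ (simp add: algebra_simps)
    moreover have "(D + \<kappa> * V s) * exp (\<kappa> * s) \<le> 0"
      using D(2) by (simp add: mult_le_0_iff)
    ultimately show "\<exists>y. ((\<lambda>s. V s * exp (\<kappa> * s)) has_real_derivative y) (at s) \<and> y \<le> 0"
      by blast
  qed
  then have "V t * (exp (\<kappa> * t) * exp (- \<kappa> * t)) \<le> V 0 * exp (- \<kappa> * t)"
    using mult_right_mono[of "V t * exp (\<kappa> * t)" "V 0" "exp (- \<kappa> * t)"] by (simp add: mult.assoc)
  then show ?thesis
    by (simp flip: exp_add)
qed

lemma strong_solution_dissipation:
  fixes L \<rho> \<mu> \<beta> \<alpha>\<^sub>1 \<gamma> \<alpha> \<xi>\<^sub>1 \<xi>\<^sub>2 \<epsilon> \<delta> :: real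
  assumes pos: "0 < L" "0 < \<beta>" "0 < \<alpha>\<^sub>1" "0 < \<epsilon>" "0 < \<delta>"
    and \<alpha>: "\<alpha> = \<alpha>\<^sub>1 + \<gamma>\<^sup>2 * \<beta>"
    and \<delta>1: "\<delta> * L * (\<rho> + (1 + \<epsilon>) * \<xi>\<^sub>1\<^sup>2 / \<alpha>\<^sub>1) \<le> 2 * \<xi>\<^sub>1"
    and \<delta>2: "\<delta> * L * (\<mu> + (1 + 1 / \<epsilon>) * \<gamma>\<^sup>2 * \<xi>\<^sub>2\<^sup>2 / \<alpha>\<^sub>1 + \<xi>\<^sub>2\<^sup>2 / \<beta>) \<le> 2 * \<xi>\<^sub>2"
    and sol: "strong_solution L \<rho> \<mu> \<alpha> \<beta> \<gamma> \<xi>\<^sub>1 \<xi>\<^sub>2 v p"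
  defines "V \<equiv> \<lambda>t. energy L \<rho> \<mu> \<alpha>\<^sub>1 \<beta> \<gamma> v p t + \<delta> * (\<integral>x. x * (\<rho> * (tderiv L v t x * wderiv L (v t) x)
      + \<mu> * (tderiv L p t x * wderiv L (p t) x)) \<partial>lebesgue_on {0<..<L})"
  shows "continuous_on {0..} V"
    and "0 < t \<Longrightarrow> \<exists>D. (V has_real_derivative D) (at t) \<and> D \<le> - \<delta> * energy L \<rho> \<mu> \<alpha>\<^sub>1 \<beta> \<gamma> v p t"
proof -
  let ?M = "lebesgue_on {0<..<L}"
  have reg: "strong_regularity L v" "strong_regularity L p"
    using sol by (auto simp: strong_solution_def)
  note v = strong_regularityD[OF pos(1) reg(1)] and p = strong_regularityD[OF pos(1) reg(2)]
  \<comment> \<open>This needs regularity but not the equations, so it also covers t = 0 and gives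
    continuity there.\<close>
  have deriv: "(V has_real_derivative (\<integral>x. J x \<partial>?M)) (at t within {0..}) \<and> integrable ?M J"
    if t: "0 \<le> t" and J: "J = (\<lambda>x. dissipation_density \<alpha> \<beta> \<gamma> \<rho> \<mu> \<delta> x (tderiv L v t x) (v' x) (tderiv L p t x) (p' x)
      (wderiv L (v t) x) (\<rho> * tderiv L (tderiv L v) t x) (wderiv L (p t) x) (\<mu> * tderiv L (tderiv L p) t x))"
    and v': "has_L2_deriv L (\<lambda>s. wderiv L (v s)) t v'" "has_L2_deriv L (\<lambda>s. wderiv L (p s)) t p'"
    for t v' p' J
    unfolding V_def energy_eq_integral_density[OF \<alpha>] J
    using lyapunov_has_derivative[OF v(3) p(3) H1_wderiv(1)[OF v(1)] H1_wderiv(1)[OF p(1)] t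
        v(4)[OF t] p(4)[OF t] v'] by blast
  show "continuous_on {0..} V"
    unfolding continuous_on_eq_continuous_within
  proof
    fix t :: real assume "t \<in> {0..}"
    then have t: "0 \<le> t" by simp
    from v(5)[OF t] p(5)[OF t] deriv[OF t refl] show "continuous (at t within {0..}) V"
      by (blast intro: DERIV_continuous)
  qed
  assume t: "0 < t"
  obtain v' where v': "v' \<in> H1_star L" "AE x in ?M. tderiv L v t x = v' x"
    "has_L2_deriv L (\<lambda>s. wderiv L (v s)) t (wderiv L v')"
    using v(5)[of t] t by auto
  obtain p' where p': "p' \<in> H1_star L" "AE x in ?M. tderiv L p t x = p' x"
    "has_L2_deriv L (\<lambda>s. wderiv L (p s)) t (wderiv L p')"
    using p(5)[of t] t by auto
  \<comment> \<open>Continuous representatives at the fixed time t, so that values at 0 and L make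
    sense. They agree almost everywhere with the functions in V, and the boundary conditions carry
    over because point values ignore null sets.\<close>
  define a b c d where "a = point_value L v'" and "b = point_value L p'"
    and "c = point_value L (wderiv L (v t))" and "d = point_value L (wderiv L (p t))"
  have H1: "v' \<in> H1 L" "p' \<in> H1 L" "wderiv L (v t) \<in> H1 L" "wderiv L (p t) \<in> H1 L"
    using v' p' v(2)[of t] p(2)[of t] t by (auto simp: H1_star_def)
  note prim = H1[THEN point_value_primitive(1)[OF pos(1)], folded a_def b_def c_def d_def]
  note AE_eq = H1[THEN point_value_primitive(2)[OF pos(1)], folded a_def b_def c_def d_def]
  have "a = point_value L (tderiv L v t)" "b = point_value L (tderiv L p t)"
    using point_value_cong_AE[OF v'(2)] point_value_cong_AE[OF p'(2)] by (auto simp: a_def b_def)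
  then have bc: "\<alpha> * c L - \<gamma> * \<beta> * d L = - \<xi>\<^sub>1 * a L" "\<beta> * d L - \<gamma> * \<beta> * c L = - \<xi>\<^sub>2 * b L"
    and pde: "AE x in ?M. \<rho> * tderiv L (tderiv L v) t x - \<alpha> * wderiv L (wderiv L (v t)) x
             + \<gamma> * \<beta> * wderiv L (wderiv L (p t)) x = 0"
      "AE x in ?M. \<mu> * tderiv L (tderiv L p) t x - \<beta> * wderiv L (wderiv L (p t)) x
             + \<gamma> * \<beta> * wderiv L (wderiv L (v t)) x = 0"
    using sol t by (auto simp: strong_solution_def c_def d_def)
  have zero: "a 0 = 0" "b 0 = 0"
    using v'(1) p'(1) by (auto simp: H1_star_def a_def b_def)
  have bdry: "a L * (\<alpha> * c L - \<gamma> * \<beta> * d L) + b L * (\<beta> * d L - \<gamma> * \<beta> * c L)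
      + \<delta> * (L * energy_density \<rho> \<mu> \<alpha> \<beta> \<gamma> (a L) (b L) (c L) (d L)) \<le> 0"
    unfolding energy_density_def by (rule boundary_dissipation[OF pos \<alpha> \<delta>1 \<delta>2 bc])
  note diss = integral_dissipation_density[OF pos(1) prim zero bdry]
  define J where "J = (\<lambda>x. dissipation_density \<alpha> \<beta> \<gamma> \<rho> \<mu> \<delta> x (tderiv L v t x) (wderiv L v' x) (tderiv L p t x) (wderiv L p' x)
      (wderiv L (v t) x) (\<rho> * tderiv L (tderiv L v) t x) (wderiv L (p t) x) (\<mu> * tderiv L (tderiv L p) t x))"
  have D: "(V has_real_derivative (\<integral>x. J x \<partial>?M)) (at t within {0..})" and int_J: "integrable ?M J"
    using deriv[OF less_imp_le[OF t] J_def v'(3) p'(3)] by auto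
  have "at t within {0..} = at t"
    using t by (intro at_within_interior) (simp add: interior_Ici)
  with D have D': "(V has_real_derivative (\<integral>x. J x \<partial>?M)) (at t)"
    by simp
  \<comment> \<open>Here the wave equations enter: \<rho> v_tt and \<mu> p_tt become the space
    derivatives of the fluxes, which turns the integrand into the one that can be integrated by
    parts.\<close>
  have "(\<integral>x. J x \<partial>?M) = (\<integral>x. dissipation_density \<alpha> \<beta> \<gamma> \<rho> \<mu> \<delta> x (a x) (wderiv L v' x) (b x) (wderiv L p' x)
      (c x) (\<alpha> * wderiv L (wderiv L (v t)) x - \<gamma> * \<beta> * wderiv L (wderiv L (p t)) x)
      (d x) (\<beta> * wderiv L (wderiv L (p t)) x - \<gamma> * \<beta> * wderiv L (wderiv L (v t)) x) \<partial>?M)"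
  proof (rule integral_cong_AE[OF borel_measurable_integrable[OF int_J] borel_measurable_integrable[OF diss(1)]])
    show "AE x in ?M. J x = dissipation_density \<alpha> \<beta> \<gamma> \<rho> \<mu> \<delta> x (a x) (wderiv L v' x) (b x) (wderiv L p' x)
      (c x) (\<alpha> * wderiv L (wderiv L (v t)) x - \<gamma> * \<beta> * wderiv L (wderiv L (p t)) x)
      (d x) (\<beta> * wderiv L (wderiv L (p t)) x - \<gamma> * \<beta> * wderiv L (wderiv L (v t)) x)"
      using v'(2) p'(2) AE_eq pde
    proof eventually_elim
      case (elim x)
      then have "\<rho> * tderiv L (tderiv L v) t x
          = \<alpha> * wderiv L (wderiv L (v t)) x - \<gamma> * \<beta> * wderiv L (wderiv L (p t)) x"
        "\<mu> * tderiv L (tderiv L p) t x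
          = \<beta> * wderiv L (wderiv L (p t)) x - \<gamma> * \<beta> * wderiv L (wderiv L (v t)) x"
        by simp_all
      with elim(1-6) show ?case
        by (simp add: J_def)
    qed
  qed
  also have "\<dots> \<le> - \<delta> * (\<integral>x. energy_density \<rho> \<mu> \<alpha> \<beta> \<gamma> (a x) (b x) (c x) (d x) \<partial>?M)"
    by (rule diss(2))
  also have "(\<integral>x. energy_density \<rho> \<mu> \<alpha> \<beta> \<gamma> (a x) (b x) (c x) (d x) \<partial>?M) = energy L \<rho> \<mu> \<alpha>\<^sub>1 \<beta> \<gamma> v p t"
    unfolding energy_eq_integral_density[OF \<alpha>]
  proof (rule integral_cong_AE)
    note [measurable] = prim[THEN primitive_on_measurable]
    show "(\<lambda>x. energy_density \<rho> \<mu> \<alpha> \<beta> \<gamma> (a x) (b x) (c x) (d x)) \<in> borel_measurable ?M"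
      unfolding energy_density_def by measurable
    show "(\<lambda>x. energy_density \<rho> \<mu> \<alpha> \<beta> \<gamma> (tderiv L v t x) (tderiv L p t x) (wderiv L (v t) x) (wderiv L (p t) x))
        \<in> borel_measurable ?M"
      using integral_energy_density(2)[OF v(3) p(3) H1_wderiv(1)[OF v(1)] H1_wderiv(1)[OF p(1)]] t by simp
    show "AE x in ?M. energy_density \<rho> \<mu> \<alpha> \<beta> \<gamma> (a x) (b x) (c x) (d x) =
        energy_density \<rho> \<mu> \<alpha> \<beta> \<gamma> (tderiv L v t x) (tderiv L p t x) (wderiv L (v t) x) (wderiv L (p t) x)"
      using v'(2) p'(2) AE_eq by eventually_elim simp
  qed
  finally show "\<exists>D. (V has_real_derivative D) (at t) \<and> D \<le> - \<delta> * energy L \<rho> \<mu> \<alpha>\<^sub>1 \<beta> \<gamma> v p t"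
    using D' by blast
qed

section \<open>Exponential decay\<close>

text \<open>With k = \<delta> L \<eta>, the functional V lies between (1 - k) E and (1 + k) E. The
  quotient of these constants is the prefactor, and V' \<le> -\<delta> E becomes decay of V at rate
  \<delta>/(1 + k).\<close>

lemma strong_solution_energy_decay:
  fixes L \<rho> \<mu> \<beta> \<alpha>\<^sub>1 \<gamma> \<alpha> \<xi>\<^sub>1 \<xi>\<^sub>2 \<epsilon> \<delta> \<eta> :: real
  assumes pos: "0 < L" "0 < \<beta>" "0 < \<alpha>\<^sub>1" "0 < \<epsilon>" "0 < \<delta>" "0 < \<rho>" "0 < \<mu>"
    and \<alpha>: "\<alpha> = \<alpha>\<^sub>1 + \<gamma>\<^sup>2 * \<beta>"
    and \<eta>: "sqrt (\<rho> / \<alpha>\<^sub>1) + sqrt (\<mu> * \<gamma>\<^sup>2 / \<alpha>\<^sub>1) \<le> \<eta>" "sqrt (\<mu> / \<beta>) + sqrt (\<mu> * \<gamma>\<^sup>2 / \<alpha>\<^sub>1) \<le> \<eta>"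
    and small: "\<delta> * L * \<eta> < 1"
    and \<delta>1: "\<delta> * L * (\<rho> + (1 + \<epsilon>) * \<xi>\<^sub>1\<^sup>2 / \<alpha>\<^sub>1) \<le> 2 * \<xi>\<^sub>1"
    and \<delta>2: "\<delta> * L * (\<mu> + (1 + 1 / \<epsilon>) * \<gamma>\<^sup>2 * \<xi>\<^sub>2\<^sup>2 / \<alpha>\<^sub>1 + \<xi>\<^sub>2\<^sup>2 / \<beta>) \<le> 2 * \<xi>\<^sub>2"
    and sol: "strong_solution L \<rho> \<mu> \<alpha> \<beta> \<gamma> \<xi>\<^sub>1 \<xi>\<^sub>2 v p"
    and t: "0 \<le> t"
  shows "energy L \<rho> \<mu> \<alpha>\<^sub>1 \<beta> \<gamma> v p t \<le> (1 + \<delta> * L * \<eta>) / (1 - \<delta> * L * \<eta>)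
     * energy L \<rho> \<mu> \<alpha>\<^sub>1 \<beta> \<gamma> v p 0 * exp (- (\<delta> * (1 - \<delta> * L * \<eta>)) * t)"
proof -
  let ?M = "lebesgue_on {0<..<L}"
  let ?E = "energy L \<rho> \<mu> \<alpha>\<^sub>1 \<beta> \<gamma> v p"
  define \<psi> where "\<psi> t = (\<integral>x. x * (\<rho> * (tderiv L v t x * wderiv L (v t) x)
      + \<mu> * (tderiv L p t x * wderiv L (p t) x)) \<partial>?M)" for t
  define V where "V t = ?E t + \<delta> * \<psi> t" for t
  define k where "k = \<delta> * L * \<eta>"
  have "0 < sqrt (\<rho> / \<alpha>\<^sub>1)" "0 \<le> sqrt (\<mu> * \<gamma>\<^sup>2 / \<alpha>\<^sub>1)"
    using pos by auto
  then have \<eta>_pos: "0 < \<eta>"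
    using \<eta>(1) by linarith
  then have k: "0 < k" "k < 1"
    using pos small by (auto simp: k_def)
  have reg: "strong_regularity L v" "strong_regularity L p"
    using sol by (auto simp: strong_solution_def)
  note v = strong_regularityD[OF pos(1) reg(1)] and p = strong_regularityD[OF pos(1) reg(2)]
  have \<psi>: "\<bar>\<psi> t\<bar> \<le> L * \<eta> * ?E t" if t: "0 \<le> t" for t
  proof -
    let ?a = "tderiv L v t" and ?b = "tderiv L p t" and ?c = "wderiv L (v t)" and ?d = "wderiv L (p t)"
    note L2 = v(3)[OF t] p(3)[OF t] H1_wderiv(1)[OF v(1)[OF t]] H1_wderiv(1)[OF p(1)[OF t]]
    have "integrable ?M (\<lambda>x. \<rho> * ((x * ?a x) * ?c x) + \<mu> * ((x * ?b x) * ?d x))"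
      using L2_integrable_mult[OF L2_weight(1)[OF L2(1)] L2(3)]
        L2_integrable_mult[OF L2_weight(1)[OF L2(2)] L2(4)] by simp
    then have int: "integrable ?M (\<lambda>x. x * (\<rho> * (?a x * ?c x) + \<mu> * (?b x * ?d x)))"
      by (simp add: algebra_simps)
    have "\<bar>\<psi> t\<bar> \<le> (\<integral>x. \<bar>x * (\<rho> * (?a x * ?c x) + \<mu> * (?b x * ?d x))\<bar> \<partial>?M)"
      unfolding \<psi>_def by (rule integral_abs_bound)
    also have "\<dots> \<le> (\<integral>x. L * \<eta> * energy_density \<rho> \<mu> \<alpha> \<beta> \<gamma> (?a x) (?b x) (?c x) (?d x) \<partial>?M)"
    proof (rule integral_mono)
      show "integrable ?M (\<lambda>x. L * \<eta> * energy_density \<rho> \<mu> \<alpha> \<beta> \<gamma> (?a x) (?b x) (?c x) (?d x))"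
        using integral_energy_density(2)[OF L2] by simp
      show "\<bar>x * (\<rho> * (?a x * ?c x) + \<mu> * (?b x * ?d x))\<bar>
          \<le> L * \<eta> * energy_density \<rho> \<mu> \<alpha> \<beta> \<gamma> (?a x) (?b x) (?c x) (?d x)" if "x \<in> space ?M" for x
        unfolding energy_density_def using that pos \<alpha> \<eta> by (intro multiplier_bound) auto
    qed (use int in simp)
    finally show ?thesis
      by (simp add: energy_eq_integral_density[OF \<alpha>])
  qed
  \<comment> \<open>Read off from the multiplier bound: 0 \<le> |\<psi>| \<le> L \<eta> E with L
    \<eta> > 0.\<close>
  have E_nonneg: "0 \<le> ?E t" if "0 \<le> t" for t
  proof -
    have "0 < L * \<eta>"
      using pos \<eta>_pos by simp
    then show ?thesis
      using order_trans[OF abs_ge_zero \<psi>[OF that]] by (metis mult_le_cancel_left_pos mult_zero_right)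
  qed
  have equiv: "(1 - k) * ?E t \<le> V t" "V t \<le> (1 + k) * ?E t" if "0 \<le> t" for t
  proof -
    have "\<bar>\<delta> * \<psi> t\<bar> \<le> k * ?E t"
      using mult_left_mono[OF \<psi>[OF that], of \<delta>] pos by (simp add: abs_mult k_def mult.assoc)
    then show "(1 - k) * ?E t \<le> V t" "V t \<le> (1 + k) * ?E t"
      by (auto simp: V_def algebra_simps abs_le_iff)
  qed
  note diss = strong_solution_dissipation[OF pos(1-5) \<alpha> \<delta>1 \<delta>2 sol, folded \<psi>_def, folded V_def]
  have decay: "V t \<le> V 0 * exp (- (\<delta> / (1 + k)) * t)"
  proof (rule exponential_decay[OF diss(1) t])
    fix s :: real assume s: "0 < s"
    obtain D where D: "(V has_real_derivative D) (at s)" "D \<le> - \<delta> * ?E s"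
      using diss(2)[OF s] by blast
    have "\<delta> / (1 + k) * V s \<le> \<delta> / (1 + k) * ((1 + k) * ?E s)"
      using equiv(2)[of s] s pos k by (intro mult_left_mono) auto
    also have "\<dots> = \<delta> * ?E s"
      using k by simp
    finally show "\<exists>D. (V has_real_derivative D) (at s) \<and> D \<le> - (\<delta> / (1 + k)) * V s"
      using D by (intro exI[of _ D]) simp
  qed
  have rate: "\<delta> * (1 - k) \<le> \<delta> / (1 + k)"
  proof -
    \<comment> \<open>1 - k^2 \<le> 1, which is where the rate of the theorem comes from, in place
      of the slightly larger \<delta>/(1 + k).\<close>
    have "(1 - k) * (1 + k) \<le> 1"
      by (simp add: algebra_simps)
    then have "1 - k \<le> 1 / (1 + k)"
      using k by (simp add: pos_le_divide_eq)
    then show ?thesis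
      using mult_left_mono[of "1 - k" "1 / (1 + k)" \<delta>] pos by simp
  qed
  have "(1 - k) * ?E t \<le> V 0 * exp (- (\<delta> / (1 + k)) * t)"
    using equiv(1)[OF t] decay by simp
  also have "\<dots> \<le> ((1 + k) * ?E 0) * exp (- (\<delta> / (1 + k)) * t)"
    using equiv(2)[of 0] by (intro mult_right_mono) auto
  \<comment> \<open>Weakening the rate requires the factor in front to be nonnegative, hence
    \<open>E_nonneg\<close>.\<close>
  also have "\<dots> \<le> ((1 + k) * ?E 0) * exp (- (\<delta> * (1 - k)) * t)"
    using mult_right_mono[OF rate t] k E_nonneg[of 0] by (intro mult_left_mono) auto
  finally have "?E t \<le> ((1 + k) * ?E 0) * exp (- (\<delta> * (1 - k)) * t) / (1 - k)"
    using k by (subst pos_le_divide_eq) (simp_all add: mult.commute[of "?E t"])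
  then show ?thesis
    unfolding k_def[symmetric] by simp
qed

section \<open>Passage from strong to weak solutions\<close>

lemma L2_norm_wderiv_diff_le:
  assumes "0 < L" "z \<in> H1 L" "w \<in> H1 L"
  shows "L2_norm L (\<lambda>x. wderiv L z x - wderiv L w x) \<le> H1_norm L (\<lambda>x. z x - w x)"
proof -
  have "L2_norm L (\<lambda>x. wderiv L z x - wderiv L w x) = L2_norm L (wderiv L (\<lambda>x. z x - w x))"
    by (rule L2_norm_cong_AE)
      (use wderiv_diff[OF assms] H1_diff(1)[OF assms(2,3)] assms in
        \<open>auto intro: L2_diff H1_wderiv elim: eventually_mono\<close>)
  also have "\<dots> \<le> H1_norm L (\<lambda>x. z x - w x)"
    by (rule L2_norm_le_H1_norm)
  finally show ?thesis .
qed

lemma energy_space_norm_ge: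
  "H1_norm L v \<le> energy_space_norm L (v, p, w, q)" "H1_norm L p \<le> energy_space_norm L (v, p, w, q)"
  "L2_norm L w \<le> energy_space_norm L (v, p, w, q)" "L2_norm L q \<le> energy_space_norm L (v, p, w, q)"
  by (auto simp: energy_space_norm_def intro!: real_le_rsqrt)

text \<open>The energy is a quadratic form in v_t, p_t, v_x and p_x, and convergence in the energy
  space gives convergence of each of these in \<open>L2\<close>.\<close>

lemma energy_tendsto:
  assumes "0 < L" and \<alpha>: "\<alpha> = \<alpha>\<^sub>1 + \<gamma>\<^sup>2 * \<beta>"
    and mem: "\<And>n. state L (vs n) (ps n) t \<in> energy_space L" "state L v p t \<in> energy_space L"
    and lim: "(\<lambda>n. energy_space_norm L (state L (vs n) (ps n) t - state L v p t)) \<longlonglongrightarrow> 0"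
  shows "(\<lambda>n. energy L \<rho> \<mu> \<alpha>\<^sub>1 \<beta> \<gamma> (vs n) (ps n) t) \<longlonglongrightarrow> energy L \<rho> \<mu> \<alpha>\<^sub>1 \<beta> \<gamma> v p t"
proof -
  have H1: "vs n t \<in> H1 L" "ps n t \<in> H1 L" "v t \<in> H1 L" "p t \<in> H1 L"
    and L2: "tderiv L (vs n) t \<in> L2 L" "tderiv L (ps n) t \<in> L2 L" "tderiv L v t \<in> L2 L" "tderiv L p t \<in> L2 L" for n
    using mem(1)[of n] mem(2) by (auto simp: state_def energy_space_def H1_star_def)
  have diff: "state L (vs n) (ps n) t - state L v p t = (\<lambda>x. vs n t x - v t x, \<lambda>x. ps n t x - p t x,
      \<lambda>x. tderiv L (vs n) t x - tderiv L v t x, \<lambda>x. tderiv L (ps n) t x - tderiv L p t x)" for n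
    by (simp add: state_def fun_diff_def)
  note lim = lim[unfolded diff]
  have tendsto: "(\<lambda>n. L2_norm L (f n)) \<longlonglongrightarrow> 0"
    if "\<And>n. L2_norm L (f n) \<le> energy_space_norm L (\<lambda>x. vs n t x - v t x, \<lambda>x. ps n t x - p t x,
      \<lambda>x. tderiv L (vs n) t x - tderiv L v t x, \<lambda>x. tderiv L (ps n) t x - tderiv L p t x)" for f
    by (rule Lim_null_comparison[OF _ lim]) (use that in auto)
  have a: "(\<lambda>n. L2_norm L (\<lambda>x. tderiv L (vs n) t x - tderiv L v t x)) \<longlonglongrightarrow> 0"
    and b: "(\<lambda>n. L2_norm L (\<lambda>x. tderiv L (ps n) t x - tderiv L p t x)) \<longlonglongrightarrow> 0"
    by (rule tendsto, rule energy_space_norm_ge)+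
  have c: "(\<lambda>n. L2_norm L (\<lambda>x. wderiv L (vs n t) x - wderiv L (v t) x)) \<longlonglongrightarrow> 0"
    and d: "(\<lambda>n. L2_norm L (\<lambda>x. wderiv L (ps n t) x - wderiv L (p t) x)) \<longlonglongrightarrow> 0"
    by (rule tendsto, rule order_trans[OF L2_norm_wderiv_diff_le[OF assms(1)]], (rule H1)+, rule energy_space_norm_ge)+
  have inner: "(\<lambda>n. \<integral>x. f n x * g n x \<partial>lebesgue_on {0<..<L}) \<longlonglongrightarrow> (\<integral>x. f' x * g' x \<partial>lebesgue_on {0<..<L})"
    if "\<And>n. f n \<in> L2 L" "\<And>n. g n \<in> L2 L" "f' \<in> L2 L" "g' \<in> L2 L"
      "(\<lambda>n. L2_norm L (\<lambda>x. f n x - f' x)) \<longlonglongrightarrow> 0" "(\<lambda>n. L2_norm L (\<lambda>x. g n x - g' x)) \<longlonglongrightarrow> 0" for f g f' g'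
    by (rule L2_integral_mult_tendsto) (use that in auto)
  show ?thesis
    unfolding energy_eq_integral_density[OF \<alpha>] integral_energy_density(1)[OF L2(1,2) H1_wderiv(1)[OF H1(1)] H1_wderiv(1)[OF H1(2)]]
      integral_energy_density(1)[OF L2(3,4) H1_wderiv(1)[OF H1(3)] H1_wderiv(1)[OF H1(4)]]
    by (intro tendsto_intros inner a b c d L2 H1_wderiv(1) H1) simp
qed

theorem theorem2:
  fixes L \<rho> \<mu> \<beta> \<alpha>\<^sub>1 \<gamma> \<alpha> \<xi>\<^sub>1 \<xi>\<^sub>2 \<eta> \<epsilon> \<delta> \<sigma> M :: real
    and f\<^sub>1 f\<^sub>2 :: "real \<Rightarrow> real \<Rightarrow> real"
    and v\<^sub>0 p\<^sub>0 v\<^sub>1 p\<^sub>1 :: "real \<Rightarrow> real"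
    and v p :: "real \<Rightarrow> real \<Rightarrow> real"
  assumes "L > 0" "\<rho> > 0" "\<mu> > 0" "\<beta> > 0" "\<alpha>\<^sub>1 > 0" "\<xi>\<^sub>1 > 0" "\<xi>\<^sub>2 > 0"
    and "\<alpha> = \<alpha>\<^sub>1 + \<gamma>\<^sup>2 * \<beta>"
    and "\<eta> = max (sqrt (\<rho> / \<alpha>\<^sub>1) + sqrt (\<mu> * \<gamma>\<^sup>2 / \<alpha>\<^sub>1)) (sqrt (\<mu> / \<beta>) + sqrt (\<mu> * \<gamma>\<^sup>2 / \<alpha>\<^sub>1))"
    and "\<And>\<xi> e. f\<^sub>1 \<xi> e = 2 * \<xi> * \<alpha>\<^sub>1 / (\<rho> * \<alpha>\<^sub>1 + (1 + e) * \<xi>\<^sup>2)"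
    and "\<And>\<xi> e. f\<^sub>2 \<xi> e = 2 * \<xi> * e * \<alpha>\<^sub>1 * \<beta> / (e * \<mu> * \<alpha>\<^sub>1 * \<beta> + (e * \<alpha> + \<gamma>\<^sup>2 * \<beta>) * \<xi>\<^sup>2)"
    and "\<epsilon> > 0" "\<delta> > 0"
    and "\<delta> < 1 / L * Min {1 / \<eta>, f\<^sub>1 \<xi>\<^sub>1 \<epsilon>, f\<^sub>2 \<xi>\<^sub>2 \<epsilon>}"
    and "\<sigma> = \<delta> * (1 - \<delta> * L * \<eta>)"
    and "M = (1 + \<delta> * L * \<eta>) / (1 - \<delta> * L * \<eta>)"
    and "(v\<^sub>0, p\<^sub>0, v\<^sub>1, p\<^sub>1) \<in> energy_space L"
    and "weak_solution L \<rho> \<mu> \<alpha> \<beta> \<gamma> \<xi>\<^sub>1 \<xi>\<^sub>2 v p"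
    and "has_initial_data L v p v\<^sub>0 p\<^sub>0 v\<^sub>1 p\<^sub>1"
  shows "\<forall>t>0. energy L \<rho> \<mu> \<alpha>\<^sub>1 \<beta> \<gamma> v p t \<le> M * energy L \<rho> \<mu> \<alpha>\<^sub>1 \<beta> \<gamma> v p 0 * exp (- \<sigma> * t)"
proof (intro allI impI)
  fix t :: real assume t: "0 < t"
  note pos = assms(1-7) and \<alpha> = assms(8) and \<eta> = assms(9)
  have "\<delta> * L < Min {1 / \<eta>, f\<^sub>1 \<xi>\<^sub>1 \<epsilon>, f\<^sub>2 \<xi>\<^sub>2 \<epsilon>}"
    using assms(14) pos(1) by (simp add: field_simps)
  then have \<delta>L: "\<delta> * L < 1 / \<eta>" "\<delta> * L < f\<^sub>1 \<xi>\<^sub>1 \<epsilon>" "\<delta> * L < f\<^sub>2 \<xi>\<^sub>2 \<epsilon>"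
    by simp_all
  have \<eta>_ge: "sqrt (\<rho> / \<alpha>\<^sub>1) + sqrt (\<mu> * \<gamma>\<^sup>2 / \<alpha>\<^sub>1) \<le> \<eta>" "sqrt (\<mu> / \<beta>) + sqrt (\<mu> * \<gamma>\<^sup>2 / \<alpha>\<^sub>1) \<le> \<eta>"
    using \<eta> by auto
  have "0 < sqrt (\<rho> / \<alpha>\<^sub>1)" "0 \<le> sqrt (\<mu> * \<gamma>\<^sup>2 / \<alpha>\<^sub>1)"
    using pos by auto
  then have "0 < \<eta>"
    using \<eta>_ge(1) by linarith
  then have small: "\<delta> * L * \<eta> < 1"
    using \<delta>L(1) by (simp add: field_simps)
  \<comment> \<open>The bound by \<open>f\<^sub>1\<close> with its denominator cleared and divided
    by \<open>\<alpha>\<^sub>1\<close>.\<close>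
  have \<delta>1: "\<delta> * L * (\<rho> + (1 + \<epsilon>) * \<xi>\<^sub>1\<^sup>2 / \<alpha>\<^sub>1) \<le> 2 * \<xi>\<^sub>1"
  proof -
    let ?q = "\<rho> * \<alpha>\<^sub>1 + (1 + \<epsilon>) * \<xi>\<^sub>1\<^sup>2"
    have q: "0 < ?q"
      using pos \<open>\<epsilon> > 0\<close> by (intro add_pos_pos mult_pos_pos) auto
    have "\<delta> * L * ?q \<le> 2 * \<xi>\<^sub>1 * \<alpha>\<^sub>1"
      using \<delta>L(2) q unfolding assms(10) by (simp add: pos_less_divide_eq)
    moreover have "\<rho> + (1 + \<epsilon>) * \<xi>\<^sub>1\<^sup>2 / \<alpha>\<^sub>1 = ?q / \<alpha>\<^sub>1"
      using pos by (simp add: field_simps)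
    ultimately show ?thesis
      using pos by (simp add: pos_divide_le_eq)
  qed
  have \<delta>2: "\<delta> * L * (\<mu> + (1 + 1 / \<epsilon>) * \<gamma>\<^sup>2 * \<xi>\<^sub>2\<^sup>2 / \<alpha>\<^sub>1 + \<xi>\<^sub>2\<^sup>2 / \<beta>) \<le> 2 * \<xi>\<^sub>2"
  proof -
    let ?q = "\<epsilon> * \<mu> * \<alpha>\<^sub>1 * \<beta> + (\<epsilon> * \<alpha> + \<gamma>\<^sup>2 * \<beta>) * \<xi>\<^sub>2\<^sup>2" and ?r = "\<epsilon> * \<alpha>\<^sub>1 * \<beta>"
    have "0 < \<alpha>"
      using pos \<alpha> by (simp add: add_pos_nonneg)
    then have q: "0 < ?q"
      using pos \<open>\<epsilon> > 0\<close> by (intro add_pos_nonneg mult_pos_pos mult_nonneg_nonneg add_nonneg_nonneg) auto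
    have r: "0 < ?r"
      using pos \<open>\<epsilon> > 0\<close> by simp
    have "\<delta> * L * ?q \<le> 2 * \<xi>\<^sub>2 * ?r"
      using \<delta>L(3) q unfolding assms(11) by (simp add: pos_less_divide_eq mult.assoc)
    \<comment> \<open>Substituting \<alpha> splits
      \<open>\<alpha> / (\<alpha>\<^sub>1 * \<beta>)\<close> into
      \<open>1 / \<beta> + \<gamma>\<^sup>2 / \<alpha>\<^sub>1\<close>; this reveals the Young
      coefficients hidden in \<open>f\<^sub>2\<close>.\<close>
    moreover have "\<mu> + (1 + 1 / \<epsilon>) * \<gamma>\<^sup>2 * \<xi>\<^sub>2\<^sup>2 / \<alpha>\<^sub>1 + \<xi>\<^sub>2\<^sup>2 / \<beta> = ?q / ?r"
      using pos \<open>\<epsilon> > 0\<close> by (simp add: \<alpha> field_simps)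
    ultimately show ?thesis
      using r by (simp add: pos_divide_le_eq)
  qed
  obtain vs ps where strong: "\<And>n. strong_solution L \<rho> \<mu> \<alpha> \<beta> \<gamma> \<xi>\<^sub>1 \<xi>\<^sub>2 (vs n) (ps n)"
    and lim: "\<And>T. 0 < T \<Longrightarrow> uniform_limit {0..T}
           (\<lambda>n t. energy_space_norm L (state L (vs n) (ps n) t - state L v p t)) (\<lambda>_. 0) sequentially"
    using assms(18) by (auto simp: weak_solution_def)
  \<comment> \<open>Convergence of the energies is needed at the two times 0 and t, both of which
    lie in the interval of uniform convergence with T = t.\<close>
  have E: "(\<lambda>n. energy L \<rho> \<mu> \<alpha>\<^sub>1 \<beta> \<gamma> (vs n) (ps n) s) \<longlonglongrightarrow> energy L \<rho> \<mu> \<alpha>\<^sub>1 \<beta> \<gamma> v p s" if s: "s \<in> {0..t}" for s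
  proof (rule energy_tendsto[OF pos(1) \<alpha>])
    show "state L (vs n) (ps n) s \<in> energy_space L" for n
    proof -
      have reg: "strong_regularity L (vs n)" "strong_regularity L (ps n)"
        using strong[of n] by (auto simp: strong_solution_def)
      then have "vs n s \<in> H1_star L" "ps n s \<in> H1_star L"
        using s by (auto simp: strong_regularity_def continuous_curve_def)
      then show ?thesis
        using reg[THEN strong_regularityD(3)[OF pos(1)]] s by (auto simp: state_def energy_space_def)
    qed
    show "state L v p s \<in> energy_space L"
      using assms(18) s by (auto simp: weak_solution_def continuous_curve_def)
    show "(\<lambda>n. energy_space_norm L (state L (vs n) (ps n) s - state L v p s)) \<longlonglongrightarrow> 0"
      by (rule tendsto_uniform_limitI[OF lim[OF t] s])
  qed
  have bound: "energy L \<rho> \<mu> \<alpha>\<^sub>1 \<beta> \<gamma> (vs n) (ps n) t \<le> M * energy L \<rho> \<mu> \<alpha>\<^sub>1 \<beta> \<gamma> (vs n) (ps n) 0 * exp (- \<sigma> * t)" for n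
    unfolding assms(15,16)
    by (rule strong_solution_energy_decay[OF pos(1,4,5) assms(12,13) pos(2,3) \<alpha> \<eta>_ge small \<delta>1 \<delta>2 strong])
      (use t in simp)
  have lim_bound: "(\<lambda>n. M * energy L \<rho> \<mu> \<alpha>\<^sub>1 \<beta> \<gamma> (vs n) (ps n) 0 * exp (- \<sigma> * t))
      \<longlonglongrightarrow> M * energy L \<rho> \<mu> \<alpha>\<^sub>1 \<beta> \<gamma> v p 0 * exp (- \<sigma> * t)"
    by (intro tendsto_intros E) (use t in simp)
  show "energy L \<rho> \<mu> \<alpha>\<^sub>1 \<beta> \<gamma> v p t \<le> M * energy L \<rho> \<mu> \<alpha>\<^sub>1 \<beta> \<gamma> v p 0 * exp (- \<sigma> * t)"
    by (rule LIMSEQ_le[OF E lim_bound]) (use t bound in auto)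
qed

end
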